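(* For every abelian T-motive $M$ over $\mathbb F_q[T]$ there exists $\mu_0$ such that for all $\mu\ge\mu_0$ the $\mu$-dual $M'^{\mu}$ of $M$ exists as an abelian T-motive, and for these $\mu$ one has $M'^{\mu+1}\cong M'^{\mu}\otimes\mathfrak C$.
   Context: $\mathbb C_\infty$ is the completion of an algebraic closure of $\mathbb F_q((1/\theta))$; $\mathbb C_\infty[T,\tau]$ has relations $Ta=aT$, $T\tau=\tau T$, $\tau a=a^q\tau$. An abelian T-motive is a left $\mathbb C_\infty[T,\tau]$-module free and finitely generated over $\mathbb C_\infty[T]$ and over $\mathbb C_\infty[\tau]$ with $(T-\theta)^m(M/\tau M)=0$ for some $m$. $\mathfrak C$ is the Carlitz motive: free of rank 1 over $\mathbb C_\infty[T]$ with basis $\mathfrak f$, $\tau\mathfrak f=(T-\theta)\mathfrak f$. Tensor products are over $\mathbb C_\infty[T]$ with $\tau(x\otimes y)=\tau x\otimes\tau y$. The $\mu$-dual: if $\tau f_*=Qf_*$ for a $\mathbb C_\infty[T]$-basis $f_*$ of $M$, then $M'^{\mu}$ is a module with a $\mathbb C_\infty[T]$-basis $f'_*$ and $\tau f'_*=(T-\theta)^\mu(Q^t)^{-1}f'_*$ (i.e. $\mathrm{Hom}(M,\mathfrak C^{\otimes\mu})$ with $\tau\varphi=\tau\circ\varphi\circ\tau^{-1}$). *)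

theory Defs
  imports
    "HOL-Library.Cardinality"
    "HOL-Computational_Algebra.Formal_Laurent_Series"
    "HOL-Computational_Algebra.Polynomial_Factorial"
    "HOL-Algebra.AbelCoset"
    "HOL-Algebra.Algebraic_Closure_Type"
    "Jordan_Normal_Form.Matrix"
begin

section \<open>The field of coefficients\<close>

text \<open>
  The type \<open>'f\<close> is the finite field with \<open>q = CARD('f)\<close> elements and \<open>'f fls\<close> is the field of
  Laurent series over it in the variable \<open>1/\<theta>\<close>, so that \<open>\<theta>\<close> is \<^const>\<open>fls_X_inv\<close>.
  The locale says that \<open>'k\<close>, with the absolute value \<open>v\<close>, is a completion of the algebraic closure
  of \<open>'f fls\<close> via the embedding \<open>j\<close>; the absolute value is normalised by \<open>v \<theta> = q\<close>.
  As \<open>'f fls\<close> is complete, its absolute value has only one extension to the algebraic closure,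
  which is therefore the restriction of \<open>v\<close> along \<open>j\<close>.
\<close>

locale C_infinity = j: field_hom j
  for v :: "'k::field \<Rightarrow> real"
    and j :: "'f::{finite,field} fls alg_closure \<Rightarrow> 'k" +
  assumes v_nonneg: "v x \<ge> 0"
    and v_eq_0_iff: "v x = 0 \<longleftrightarrow> x = 0"
    and v_mult: "v (x * y) = v x * v y"
    and v_add: "v (x + y) \<le> max (v x) (v y)"
    and v_extends: "g \<noteq> 0 \<Longrightarrow> v (j (to_ac g)) = real CARD('f) powi (- fls_subdegree g)"
    and dense: "\<epsilon> > 0 \<Longrightarrow> \<exists>a. v (x - j a) < \<epsilon>"
    and complete:
      "(\<And>\<epsilon>. \<epsilon> > 0 \<Longrightarrow> \<exists>n0. \<forall>m\<ge>n0. \<forall>n\<ge>n0. v (s m - s n) < \<epsilon>) \<Longrightarrow>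
        \<exists>x. (\<lambda>n. v (s n - x)) \<longlonglongrightarrow> 0"

section \<open>Left modules over a ring that need not be commutative\<close>

locale left_module = R: ring R + M: abelian_group M
  for R :: "('r, 'c) ring_scheme" and M :: "('r, 'm, 'd) module_scheme" +
  assumes smult_closed:
      "a \<in> carrier R \<Longrightarrow> x \<in> carrier M \<Longrightarrow> a \<odot>\<^bsub>M\<^esub> x \<in> carrier M"
    and smult_l_distr:
      "a \<in> carrier R \<Longrightarrow> b \<in> carrier R \<Longrightarrow> x \<in> carrier M \<Longrightarrow>
        (a \<oplus>\<^bsub>R\<^esub> b) \<odot>\<^bsub>M\<^esub> x = a \<odot>\<^bsub>M\<^esub> x \<oplus>\<^bsub>M\<^esub> b \<odot>\<^bsub>M\<^esub> x"
    and smult_r_distr: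
      "a \<in> carrier R \<Longrightarrow> x \<in> carrier M \<Longrightarrow> y \<in> carrier M \<Longrightarrow>
        a \<odot>\<^bsub>M\<^esub> (x \<oplus>\<^bsub>M\<^esub> y) = a \<odot>\<^bsub>M\<^esub> x \<oplus>\<^bsub>M\<^esub> a \<odot>\<^bsub>M\<^esub> y"
    and smult_assoc:
      "a \<in> carrier R \<Longrightarrow> b \<in> carrier R \<Longrightarrow> x \<in> carrier M \<Longrightarrow>
        (a \<otimes>\<^bsub>R\<^esub> b) \<odot>\<^bsub>M\<^esub> x = a \<odot>\<^bsub>M\<^esub> (b \<odot>\<^bsub>M\<^esub> x)"
    and smult_one: "x \<in> carrier M \<Longrightarrow> \<one>\<^bsub>R\<^esub> \<odot>\<^bsub>M\<^esub> x = x"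

definition restrict_scalars ::
  "('s \<Rightarrow> 'r) \<Rightarrow> ('r, 'm) module \<Rightarrow> ('s, 'm) module" where
  "restrict_scalars \<phi> M =
     \<lparr>carrier = carrier M, monoid.mult = monoid.mult M, one = one M, zero = zero M, add = add M,
      module.smult = (\<lambda>s x. \<phi> s \<odot>\<^bsub>M\<^esub> x)\<rparr>"

definition module_basis ::
  "('r, 'c) ring_scheme \<Rightarrow> ('r, 'm) module \<Rightarrow> nat \<Rightarrow> (nat \<Rightarrow> 'm) \<Rightarrow> bool" where
  "module_basis R M n b \<longleftrightarrow>
     (\<forall>i<n. b i \<in> carrier M) \<and>
     (\<forall>x\<in>carrier M. \<exists>!c. c \<in> {..<n} \<rightarrow>\<^sub>E carrier R \<and>
        x = (\<Oplus>\<^bsub>M\<^esub>i\<in>{..<n}. c i \<odot>\<^bsub>M\<^esub> b i))"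

definition free_fin_gen :: "('r, 'c) ring_scheme \<Rightarrow> ('r, 'm) module \<Rightarrow> bool" where
  "free_fin_gen R M \<longleftrightarrow> (\<exists>n b. module_basis R M n b)"

definition left_module_isomorphic ::
  "('r, 'c) ring_scheme \<Rightarrow> ('r, 'm) module \<Rightarrow> ('r, 'n) module \<Rightarrow> bool" where
  "left_module_isomorphic R M N \<longleftrightarrow>
     (\<exists>h. bij_betw h (carrier M) (carrier N) \<and>
       (\<forall>x\<in>carrier M. \<forall>y\<in>carrier M. h (x \<oplus>\<^bsub>M\<^esub> y) = h x \<oplus>\<^bsub>N\<^esub> h y) \<and>
       (\<forall>a\<in>carrier R. \<forall>x\<in>carrier M. h (a \<odot>\<^bsub>M\<^esub> x) = a \<odot>\<^bsub>N\<^esub> h x))"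

section \<open>Skew polynomial rings\<close>

text \<open>
  An element \<open>p\<close> of the ring below stands for the sum of the \<open>coeff p i * \<tau>^i\<close>, with the
  coefficients on the left; the multiplication is determined by \<open>\<tau> a = \<sigma>(a) \<tau>\<close>.
\<close>

definition skew_poly_ring :: "('a::comm_ring_1 \<Rightarrow> 'a) \<Rightarrow> 'a poly ring" where
  "skew_poly_ring \<sigma> =
     \<lparr>carrier = UNIV,
      monoid.mult = (\<lambda>a b. \<Sum>i\<le>degree a. \<Sum>j\<le>degree b.
                monom (coeff a i * (\<sigma> ^^ i) (coeff b j)) (i + j)),
      one = 1, zero = 0, add = (+)\<rparr>"

definition frob :: "nat \<Rightarrow> 'k::field poly \<Rightarrow> 'k poly" where
  "frob q = map_poly (\<lambda>c. c ^ q)"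

text \<open>
  In \<open>'k poly poly\<close> the inner variable is \<open>T\<close> and the outer one is \<open>\<tau>\<close>.
\<close>

abbreviation ring_T :: "'k::field poly ring" where
  "ring_T \<equiv> ring_of_type_algebra"

definition ring_tau :: "nat \<Rightarrow> 'k::field poly ring" where
  "ring_tau q = skew_poly_ring (\<lambda>c. c ^ q)"

definition ring_T_tau :: "nat \<Rightarrow> 'k::field poly poly ring" where
  "ring_T_tau q = skew_poly_ring (frob q)"

definition tau :: "'k::field poly poly" where
  "tau = [:0, 1:]"

definition over_T :: "('k::field poly poly, 'm) module \<Rightarrow> ('k poly, 'm) module" where
  "over_T = restrict_scalars (\<lambda>p. [:p:])"

definition over_tau :: "('k::field poly poly, 'm) module \<Rightarrow> ('k poly, 'm) module" where
  "over_tau = restrict_scalars (map_poly (\<lambda>c. [:c:]))"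

section \<open>T-motives\<close>

definition T_minus :: "'k::field \<Rightarrow> 'k poly" where
  "T_minus \<theta> = [:- \<theta>, 1:]"

definition abelian_T_motive ::
  "nat \<Rightarrow> 'k::field \<Rightarrow> ('k poly poly, 'm) module \<Rightarrow> bool" where
  "abelian_T_motive q \<theta> M \<longleftrightarrow>
     left_module (ring_T_tau q) M \<and>
     free_fin_gen ring_T (over_T M) \<and>
     free_fin_gen (ring_tau q) (over_tau M) \<and>
     (\<exists>m. \<forall>x\<in>carrier M. T_minus \<theta> ^ m \<odot>\<^bsub>over_T M\<^esub> x \<in> (\<lambda>y. tau \<odot>\<^bsub>M\<^esub> y) ` carrier M)"

text \<open>
  The basis vector of the Carlitz motive is \<open>1\<close>; \<open>\<tau>\<close> maps \<open>p\<close>, that is \<open>p\<close> times the basis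
  vector, to \<open>frob q p * (T - \<theta>)\<close> times the basis vector.
\<close>

definition carlitz_motive :: "nat \<Rightarrow> 'k::field \<Rightarrow> ('k poly poly, 'k poly) module" where
  "carlitz_motive q \<theta> =
     \<lparr>carrier = UNIV, monoid.mult = (*), one = 1, zero = 0, add = (+),
      module.smult = (\<lambda>a x. \<Sum>i\<le>degree a. coeff a i * ((\<lambda>p. frob q p * T_minus \<theta>) ^^ i) x)\<rparr>"

definition tau_matrix ::
  "('k::field poly poly, 'm) module \<Rightarrow> nat \<Rightarrow> (nat \<Rightarrow> 'm) \<Rightarrow> 'k poly mat \<Rightarrow> bool" where
  "tau_matrix M r f Q \<longleftrightarrow>
     module_basis ring_T (over_T M) r f \<and> Q \<in> carrier_mat r r \<and>
     (\<forall>i<r. tau \<odot>\<^bsub>M\<^esub> f i =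
        (\<Oplus>\<^bsub>over_T M\<^esub>j\<in>{..<r}. Q $$ (i, j) \<odot>\<^bsub>over_T M\<^esub> f j))"

text \<open>
  The matrix \<open>R\<close> below is the inverse of the transpose of \<open>Q\<close> over the field of rational
  functions in \<open>T\<close>.  That a polynomial matrix \<open>Q'\<close> equals \<open>(T - \<theta>)^\<mu> R\<close> is part of
  the existence of the dual.
\<close>

definition is_mu_dual ::
  "nat \<Rightarrow> 'k::field \<Rightarrow> nat \<Rightarrow> ('k poly poly, 'm) module \<Rightarrow> ('k poly poly, 'n) module \<Rightarrow> bool" where
  "is_mu_dual q \<theta> \<mu> M N \<longleftrightarrow>
     left_module (ring_T_tau q) N \<and>
     (\<exists>r f f' Q Q' R.
        tau_matrix M r f Q \<and> tau_matrix N r f' Q' \<and>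
        R \<in> carrier_mat r r \<and>
        inverts_mat (map_mat to_fract (transpose_mat Q)) R \<and>
        inverts_mat R (map_mat to_fract (transpose_mat Q)) \<and>
        map_mat to_fract Q' = to_fract (T_minus \<theta> ^ \<mu>) \<cdot>\<^sub>m R)"

section \<open>Tensor products over the polynomial ring in T\<close>

text \<open>
  The tensor product is the quotient of the free module over \<open>'k poly\<close> on the set of pairs by the
  submodule generated by the bilinearity relations.  The free module carries the action of
  \<open>\<tau>\<close> that is semilinear for \<^const>\<open>frob\<close> and maps the pair \<open>(x, y)\<close> to \<open>(\<tau> x, \<tau> y)\<close>.
\<close>

definition pair_tau ::
  "nat \<Rightarrow> ('k::field poly poly, 'm) module \<Rightarrow> ('k poly poly, 'n) module \<Rightarrow>
   ('m \<times> 'n \<Rightarrow> 'k poly) \<Rightarrow> ('m \<times> 'n \<Rightarrow> 'k poly)" where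
  "pair_tau q M N g =
     (\<lambda>w. \<Sum>z | g z \<noteq> 0 \<and> (tau \<odot>\<^bsub>M\<^esub> fst z, tau \<odot>\<^bsub>N\<^esub> snd z) = w. frob q (g z))"

definition pair_module ::
  "nat \<Rightarrow> ('k::field poly poly, 'm) module \<Rightarrow> ('k poly poly, 'n) module \<Rightarrow>
   ('k poly poly, 'm \<times> 'n \<Rightarrow> 'k poly) module" where
  "pair_module q M N =
     \<lparr>carrier = {g. finite {z. g z \<noteq> 0} \<and> {z. g z \<noteq> 0} \<subseteq> carrier M \<times> carrier N},
      monoid.mult = undefined, one = undefined,
      zero = (\<lambda>_. 0), add = (\<lambda>g h z. g z + h z),
      module.smult = (\<lambda>a g z. \<Sum>i\<le>degree a. coeff a i * (pair_tau q M N ^^ i) g z)\<rparr>"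

definition single :: "'a \<Rightarrow> 'a \<Rightarrow> 'b::zero_neq_one" where
  "single z = (\<lambda>w. if w = z then 1 else 0)"

inductive_set bilinear_rels ::
  "('k::field poly poly, 'm) module \<Rightarrow> ('k poly poly, 'n) module \<Rightarrow> ('m \<times> 'n \<Rightarrow> 'k poly) set"
  for M :: "('k::field poly poly, 'm) module" and N :: "('k poly poly, 'n) module" where
  zero: "(\<lambda>_. 0) \<in> bilinear_rels M N"
| add: "g \<in> bilinear_rels M N \<Longrightarrow> h \<in> bilinear_rels M N \<Longrightarrow> (\<lambda>z. g z + h z) \<in> bilinear_rels M N"
| scale: "g \<in> bilinear_rels M N \<Longrightarrow> (\<lambda>z. p * g z) \<in> bilinear_rels M N"
| add_left: "x \<in> carrier M \<Longrightarrow> x' \<in> carrier M \<Longrightarrow> y \<in> carrier N \<Longrightarrow>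
    (\<lambda>z. single (x \<oplus>\<^bsub>M\<^esub> x', y) z - single (x, y) z - single (x', y) z) \<in> bilinear_rels M N"
| add_right: "x \<in> carrier M \<Longrightarrow> y \<in> carrier N \<Longrightarrow> y' \<in> carrier N \<Longrightarrow>
    (\<lambda>z. single (x, y \<oplus>\<^bsub>N\<^esub> y') z - single (x, y) z - single (x, y') z) \<in> bilinear_rels M N"
| scale_left: "x \<in> carrier M \<Longrightarrow> y \<in> carrier N \<Longrightarrow>
    (\<lambda>z. single (p \<odot>\<^bsub>over_T M\<^esub> x, y) z - p * single (x, y) z) \<in> bilinear_rels M N"
| scale_right: "x \<in> carrier M \<Longrightarrow> y \<in> carrier N \<Longrightarrow>
    (\<lambda>z. single (x, p \<odot>\<^bsub>over_T N\<^esub> y) z - p * single (x, y) z) \<in> bilinear_rels M N"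

definition tensor_motive ::
  "nat \<Rightarrow> ('k::field poly poly, 'm) module \<Rightarrow> ('k poly poly, 'n) module \<Rightarrow>
   ('k poly poly, ('m \<times> 'n \<Rightarrow> 'k poly) set) module" where
  "tensor_motive q M N =
     (let F = pair_module q M N; K = bilinear_rels M N in
      \<lparr>carrier = a_rcosets\<^bsub>F\<^esub> K, monoid.mult = undefined, one = undefined,
       zero = K, add = (\<lambda>A B. A <+>\<^bsub>F\<^esub> B),
       module.smult = (\<lambda>a A. \<Union>g\<in>A. K +>\<^bsub>F\<^esub> (a \<odot>\<^bsub>F\<^esub> g))\<rparr>)"

end

theory Submission
  imports Defs "Jordan_Normal_Form.Determinant"
begin

text \<open>
  Let \<open>\<tau> f = Q f\<close> on \<open>M\<close>. As \<open>(T - \<theta>)^m M \<subseteq> \<tau> M\<close>, the matrix \<open>(T - \<theta>)^m Q^{-1}\<close> is polynomial,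
  so the dual is a module over \<open>K[T, \<tau>]\<close> for \<open>\<mu> \<ge> m\<close>. If moreover \<open>\<mu>\<close> exceeds the degrees of the
  entries of \<open>Q\<close>, then \<open>\<tau>\<close> strictly raises degrees on the dual, because its inverse is given by
  \<open>(T - \<theta>)^{-\<mu>} Q^t\<close>. Ordering the monomials \<open>T^k f'_i\<close> by \<open>k\<close> and then \<open>i\<close>, those that are not leading
  monomials of elements of the image of \<open>\<tau>\<close> are finite in number, since the image contains
  \<open>(T - \<theta>)^\<mu>\<close> times everything, and they form a basis over \<open>K[\<tau>]\<close>. This uses that \<open>K\<close> is perfect.
\<close>

text \<open>A polynomial dual matrix is not enough: for the Carlitz motive and \<mu> = 1 it equals
  1, \<tau> preserves degrees, and K[T] is not finitely generated over K[\<tau>]. A strict rise of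
  degrees helps because cancelling a leading term by an element of the image of \<tau> uses a
  preimage of smaller degree, so the reduction ends; it also makes \<tau> injective, which gives
  independence. In the second claim the two duals are arbitrary, with unrelated bases and ranks that
  are a priori different. They are compared through their pairings with M. As the Carlitz motive has
  rank 1, tensoring N with it amounts to replacing \<tau> on N by (T - \<theta>) \<tau>; the work
  lies in recognising the cosets of the bilinearity relations as the fibres of a contraction
  map.\<close>

section \<open>Finite fields and perfectness of the coefficient field\<close>

lemma finite_field_power_card:
  fixes x :: "'f::{finite,field}"
  shows "x ^ CARD('f) = x"
proof (cases "x = 0")
  case False
  \<comment> \<open>Multiplication by \<open>x\<close> permutes the nonzero elements, so their
    product absorbs the factor \<open>x ^ card A\<close>.\<close>
  define A where "A = UNIV - {0::'f}"
  have A: "finite A" "0 \<notin> A" "card A = CARD('f) - 1" by (auto simp: A_def)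
  have "bij_betw ((*) x) A A"
    unfolding bij_betw_def
  proof
    show "inj_on ((*) x) A" using False by (auto simp: inj_on_def)
    have "y \<in> (*) x ` A" if "y \<in> A" for y
      using that False by (intro image_eqI[of _ _ "y / x"]) (auto simp: A_def)
    then show "(*) x ` A = A" using False by (auto simp: A_def)
  qed
  then have "(\<Prod>y\<in>A. x * y) = \<Prod>A"
    by (rule prod.reindex_bij_betw)
  then have "x ^ card A * \<Prod>A = 1 * \<Prod>A"
    by (simp add: prod.distrib)
  moreover have "\<Prod>A \<noteq> 0" using A by auto
  ultimately have "x ^ card A = 1" by (metis mult_right_cancel)
  then have "x ^ Suc (card A) = x" by simp
  moreover have "Suc (card A) = CARD('f)" using A(3) finite_UNIV_card_ge_0[where 'a='f] by simp
  ultimately show ?thesis by simp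
qed (simp add: power_0_left)

text \<open>The polynomial \<open>(X + 1)^q - X^q - 1\<close> vanishes at all \<open>q\<close> elements of the field and has
  degree less than \<open>q\<close>.\<close>

lemma finite_field_binomial_eq_0:
  assumes "0 < i" "i < CARD('f::{finite,field})"
  shows "of_nat (CARD('f) choose i) = (0 :: 'f)"
proof -
  let ?q = "CARD('f)"
  define P where "P = [:1, 1::'f:] ^ ?q - monom 1 ?q - 1"
  have coeff_P: "coeff P n = of_nat (?q choose n) - (if n = ?q then 1 else 0) - (if n = 0 then 1 else 0)"
    for n
  proof (cases "n \<le> ?q")
    case True
    then show ?thesis by (simp add: P_def coeff_linear_poly_power coeff_1)
  next
    case False
    moreover have "degree ([:1, 1::'f:] ^ ?q) = ?q"
      by (simp add: degree_power_eq)
    ultimately show ?thesis by (auto simp: P_def coeff_eq_0 coeff_1 binomial_eq_0)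
  qed
  have "P = 0"
  proof (rule ccontr)
    assume "P \<noteq> 0"
    have "poly P x = 0" for x
    proof -
      have "poly P x = (x + 1) ^ ?q - x ^ ?q - 1"
        by (simp add: P_def poly_monom add.commute)
      then show ?thesis by (simp add: finite_field_power_card)
    qed
    then have "{x. poly P x = 0} = UNIV" by auto
    then have "?q \<le> degree P"
      using card_poly_roots_bound[OF \<open>P \<noteq> 0\<close>] by simp
    moreover have "degree P \<le> ?q - 1"
      by (rule degree_le) (auto simp: coeff_P binomial_eq_0)
    moreover have "?q > 0" by (simp add: finite_UNIV_card_ge_0)
    ultimately have "?q = 0" by linarith
    then show False by simp
  qed
  then show ?thesis using coeff_P[of i] assms by simp
qed

context C_infinity
begin

text \<open>The characteristic of \<open>'f\<close> divides the inner binomial coefficients; the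
  algebraic closure of the Laurent series has the same characteristic, and the homomorphism
  \<open>j\<close> carries the vanishing to \<open>'k\<close>.\<close>

lemma freshmans_dream_card: "(a + b :: 'k) ^ CARD('f) = a ^ CARD('f) + b ^ CARD('f)"
proof -
  let ?q = "CARD('f)"
  have q: "?q > 0" by (simp add: finite_UNIV_card_ge_0)
  have binom: "of_nat (?q choose i) = (0 :: 'k)" if i: "0 < i" "i < ?q" for i
  proof -
    have "CHAR('f) dvd (?q choose i)"
      using finite_field_binomial_eq_0[OF i] by (simp add: of_nat_eq_0_iff_char_dvd)
    then have "of_nat (?q choose i) = (0 :: 'f fls alg_closure)"
      by (simp add: of_nat_eq_0_iff_char_dvd)
    then have "j (of_nat (?q choose i)) = 0" by simp
    then show ?thesis by (simp add: j.hom_of_nat)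
  qed
  have "(a + b) ^ ?q = (\<Sum>i\<le>?q. of_nat (?q choose i) * a ^ i * b ^ (?q - i))"
    by (rule binomial_ring)
  also have "\<dots> = (\<Sum>i\<in>{0, ?q}. of_nat (?q choose i) * a ^ i * b ^ (?q - i))"
    by (rule sum.mono_neutral_right) (auto simp: binom)
  finally show ?thesis using q by (simp add: add.commute)
qed

lemma v_power: "v (x ^ n) = v x ^ n"
proof (induction n)
  case 0
  have "v 1 * v 1 = v 1" using v_mult[of 1 1] by simp
  then show ?case using v_eq_0_iff[of 1] by simp
qed (simp add: v_mult)

lemma v_minus: "v (- x) = v x"
proof -
  have "v (- 1) ^ 2 = 1" using v_power[of "-1" 2] v_power[of 1 0] by simp
  then have "v (- 1) = 1" using v_nonneg[of "-1"] by (metis abs_of_nonneg power2_eq_1_iff abs_minus_cancel abs_one)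
  then show ?thesis using v_mult[of "-1" x] by simp
qed

text \<open>Extract \<open>q\<close>-th roots in the algebraic closure and pass to the limit: as \<open>v (a^q - b^q)\<close> is
  \<open>v (a - b)^q\<close>, roots of a convergent sequence form a Cauchy sequence.\<close>

lemma power_card_surj: "\<exists>d::'k. d ^ CARD('f) = c"
proof -
  let ?q = "CARD('f)"
  have q: "?q > 0" by (simp add: finite_UNIV_card_ge_0)
  have diff: "(a - b :: 'k) ^ ?q = a ^ ?q - b ^ ?q" for a b
    using freshmans_dream_card[of "a - b" b] by (simp add: algebra_simps)
  have "\<exists>s. v (c - s ^ ?q) < 1 / Suc n" for n
  proof -
    obtain a where a: "v (c - j a) < 1 / Suc n" using dense[of "1 / Suc n" c] by auto
    obtain b where "b ^ ?q = a" using nth_root_exists[OF q] by blast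
    then have "j b ^ ?q = j a" by (metis j.hom_power)
    then show ?thesis using a by metis
  qed
  then obtain s where s: "\<And>n. v (c - s n ^ ?q) < 1 / Suc n" by metis
  have conv: "(\<lambda>n. v (c - s n ^ ?q)) \<longlonglongrightarrow> 0"
  proof (rule tendsto_sandwich[OF _ _ tendsto_const LIMSEQ_Suc[OF lim_1_over_n]])
    show "\<forall>\<^sub>F n in sequentially. v (c - s n ^ ?q) \<le> 1 / real (Suc n)"
      using s by (auto intro!: always_eventually less_imp_le)
  qed (simp add: v_nonneg)
  \<comment> \<open>Write x - y as (z - y) - (z - x).\<close>
  have ultra: "v (x - y) \<le> max (v (z - x)) (v (z - y))" for x y z
    using v_add[of "- (z - x)" "z - y"] v_minus[of "z - x"] by simp
  obtain y where y: "(\<lambda>n. v (s n - y)) \<longlonglongrightarrow> 0"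
  proof -
    have "\<exists>n0. \<forall>m\<ge>n0. \<forall>n\<ge>n0. v (s m - s n) < e" if e: "e > 0" for e
    proof -
      have "\<forall>\<^sub>F n in sequentially. v (c - s n ^ ?q) < e ^ ?q"
        using conv e by (intro order_tendstoD(2)) auto
      then obtain n0 where n0: "\<And>n. n \<ge> n0 \<Longrightarrow> v (c - s n ^ ?q) < e ^ ?q"
        by (auto simp: eventually_sequentially)
      have "v (s m - s n) < e" if "m \<ge> n0" "n \<ge> n0" for m n
      proof -
        have "v (s m - s n) ^ ?q = v (s m ^ ?q - s n ^ ?q)"
          by (simp flip: v_power diff)
        also have "\<dots> \<le> max (v (c - s m ^ ?q)) (v (c - s n ^ ?q))" by (rule ultra)
        also have "\<dots> < e ^ ?q" using n0 that by simp
        finally show ?thesis using e by (meson power_less_imp_less_base less_imp_le)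
      qed
      then show ?thesis by blast
    qed
    from complete[OF this] show thesis using that by blast
  qed
  \<comment> \<open>Additivity of the power map gives c - y^q = (c - s_n^q) + (s_n - y)^q, and both
    summands tend to 0.\<close>
  have "(\<lambda>n. max (v (c - s n ^ ?q)) (v (s n - y) ^ ?q)) \<longlonglongrightarrow> max 0 (0 ^ ?q)"
    by (intro tendsto_max conv tendsto_power y)
  moreover have "v (c - y ^ ?q) \<le> max (v (c - s n ^ ?q)) (v (s n - y) ^ ?q)" for n
    using v_add[of "c - s n ^ ?q" "(s n - y) ^ ?q"] by (simp add: v_power flip: v_power) (simp add: diff)
  ultimately have "v (c - y ^ ?q) \<le> max 0 (0 ^ ?q)"
    by (intro LIMSEQ_le_const) auto
  then have "v (c - y ^ ?q) = 0" using v_nonneg[of "c - y ^ ?q"] q by (simp add: power_0_left)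
  then show ?thesis using v_eq_0_iff by (metis eq_iff_diff_eq_0)
qed

end

section \<open>The Frobenius on polynomials\<close>

text \<open>What the motives use of the coefficient field: the \<open>q\<close>-th power map is an
  automorphism. Its injectivity is automatic, as nonzero elements have nonzero powers. The parameter
  \<open>ty\<close> only pins down the type \<open>'k\<close>, which \<open>q\<close> does not
  mention.\<close>

locale bij_frobenius =
  fixes q :: nat and ty :: "'k::field itself"
  assumes power_q_add: "(a + b :: 'k) ^ q = a ^ q + b ^ q"
    and power_q_surj: "\<exists>d::'k. d ^ q = c"
    and q_pos: "q > 0"
begin

lemma coeff_frob: "coeff (frob q (p::'k poly)) n = coeff p n ^ q"
  using q_pos by (simp add: frob_def coeff_map_poly)

lemma power_q_sum: "(\<Sum>x\<in>A. f x :: 'k) ^ q = (\<Sum>x\<in>A. f x ^ q)"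
  using q_pos by (induction A rule: infinite_finite_induct) (auto simp: power_q_add)

lemma frob_0 [simp]: "frob q (0::'k poly) = 0"
  by (simp add: frob_def)

lemma frob_1 [simp]: "frob q (1::'k poly) = 1"
  using q_pos by (auto simp: poly_eq_iff coeff_frob coeff_1)

lemma frob_add: "frob q (a + b :: 'k poly) = frob q a + frob q b"
  by (simp add: poly_eq_iff coeff_frob power_q_add)

lemma frob_sum: "frob q (\<Sum>x\<in>A. f x :: 'k poly) = (\<Sum>x\<in>A. frob q (f x))"
  by (induction A rule: infinite_finite_induct) (auto simp: frob_add)

lemma frob_mult: "frob q (a * b :: 'k poly) = frob q a * frob q b"
  by (simp add: poly_eq_iff coeff_frob coeff_mult power_q_sum power_mult_distrib)

lemma degree_frob [simp]: "degree (frob q (p::'k poly)) = degree p"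
  unfolding frob_def using q_pos by (intro degree_map_poly) auto

lemma frob_eq_0_iff [simp]: "frob q (p::'k poly) = 0 \<longleftrightarrow> p = 0"
  using q_pos by (auto simp: poly_eq_iff coeff_frob)

lemma frob_surj: "\<exists>p'. frob q p' = (p::'k poly)"
proof -
  from power_q_surj obtain g where g: "\<And>c::'k. g c ^ q = c" by metis
  then have "g 0 ^ q = 0" by blast
  then have g0: "g 0 = 0" using q_pos by simp
  have "frob q (map_poly g p) = p"
    by (simp add: poly_eq_iff coeff_frob coeff_map_poly g0 g)
  then show ?thesis by blast
qed

end

section \<open>Skew polynomials acting on sequences of powers\<close>

text \<open>With \<open>F i\<close> standing for \<tau>^i x this is the action of the skew
  polynomial \<open>a\<close> on \<open>x\<close>. Leaving \<open>F\<close> free lets one set of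
  rules serve single coordinates of vectors, the Carlitz motive and the free module on
  pairs.\<close>

definition lin_eval :: "'a::comm_ring_1 poly \<Rightarrow> (nat \<Rightarrow> 'a) \<Rightarrow> 'a" where
  "lin_eval a F = (\<Sum>i\<le>degree a. coeff a i * F i)"

lemma lin_eval_eq_sum:
  assumes "degree a \<le> n"
  shows "lin_eval a F = (\<Sum>i\<le>n. coeff a i * F i)"
  unfolding lin_eval_def using assms
  by (intro sum.mono_neutral_left) (auto simp: coeff_eq_0)

lemma lin_eval_0 [simp]: "lin_eval 0 F = 0"
  by (simp add: lin_eval_def)

lemma lin_eval_add: "lin_eval (a + b) F = lin_eval a F + lin_eval b F"
proof -
  define n where "n = max (degree a) (degree b)"
  have "degree (a + b) \<le> n" "degree a \<le> n" "degree b \<le> n"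
    by (auto simp: n_def degree_add_le_max)
  then show ?thesis by (simp add: lin_eval_eq_sum[of _ n] sum.distrib algebra_simps)
qed

lemma lin_eval_sum: "lin_eval (\<Sum>x\<in>A. f x) F = (\<Sum>x\<in>A. lin_eval (f x) F)"
  by (induction A rule: infinite_finite_induct) (auto simp: lin_eval_add)

lemma lin_eval_monom: "lin_eval (monom c n) F = c * F n"
  by (simp add: lin_eval_eq_sum[OF degree_monom_le] coeff_monom if_distrib[of "\<lambda>c. c * _"] cong: if_cong)

lemma lin_eval_pCons: "lin_eval (pCons c a) F = c * F 0 + lin_eval a (\<lambda>i. F (Suc i))"
proof -
  have "lin_eval (pCons c a) F = (\<Sum>i\<le>Suc (degree a). coeff (pCons c a) i * F i)"
    by (rule lin_eval_eq_sum) (rule degree_pCons_le)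
  also have "\<dots> = c * F 0 + lin_eval a (\<lambda>i. F (Suc i))"
    unfolding lin_eval_def by (subst sum.atMost_Suc_shift) simp
  finally show ?thesis .
qed

text \<open>The inclusion used by \<open>over_tau\<close>, for an arbitrary inner variable: in
  \<open>comb\<close> below it is the variable of the polynomials on which \<open>S\<close> acts,
  not T.\<close>

definition const_coeffs :: "'a::comm_ring_1 poly \<Rightarrow> 'a poly poly" where
  "const_coeffs = map_poly (\<lambda>c. [:c:])"

lemma const_coeffs_0 [simp]: "const_coeffs 0 = 0"
  by (simp add: const_coeffs_def)

lemma const_coeffs_add: "const_coeffs (a + b) = const_coeffs a + const_coeffs b"
  by (simp add: const_coeffs_def poly_eq_iff coeff_map_poly)

lemma const_coeffs_pCons: "const_coeffs (pCons c a) = pCons [:c:] (const_coeffs a)"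
  by (simp add: const_coeffs_def map_poly_pCons)

text \<open>
  A semilinear map \<open>S\<close> that raises degrees makes \<open>'k poly\<close> a free module over the skew polynomials:
  a basis consists of the powers of the variable whose exponent is not the degree of any element of
  the image of \<open>S\<close>.
\<close>

locale degree_raising = bij_frobenius q ty for q and ty :: "'k::field itself" +
  fixes S :: "'k poly \<Rightarrow> 'k poly" and B :: "nat set"
  assumes S_add: "S (x + y) = S x + S y"
    and S_smult: "S (smult c x) = smult (c ^ q) (S x)"
    and degree_S: "x \<noteq> 0 \<Longrightarrow> degree x < degree (S x)"
    and B_eq: "B = {n. \<nexists>x. x \<noteq> 0 \<and> degree (S x) = n}"
    and finite_B: "finite B"
begin

definition comb :: "(nat \<Rightarrow> 'k poly) \<Rightarrow> 'k poly" where
  "comb c = (\<Sum>b\<in>B. lin_eval (const_coeffs (c b)) (\<lambda>i. (S ^^ i) (monom 1 b)))"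

lemma S_0 [simp]: "S 0 = 0"
  using S_add[of 0 0] by (metis add.right_neutral add_left_cancel)

lemma degree_S_notin_B: "x \<noteq> 0 \<Longrightarrow> degree (S x) \<notin> B"
  unfolding B_eq by blast

lemma S_minus: "S (- x) = - S x"
  using S_add[of x "-x"] by (simp add: eq_neg_iff_add_eq_0 add.commute)

lemma S_sum: "S (\<Sum>x\<in>A. f x) = (\<Sum>x\<in>A. S (f x))"
  by (induction A rule: infinite_finite_induct) (auto simp: S_add)

lemma comb_0: "comb (\<lambda>_. 0) = 0"
  by (simp add: comb_def)

lemma comb_add: "comb (\<lambda>b. c b + c' b) = comb c + comb c'"
  by (simp add: comb_def const_coeffs_add lin_eval_add sum.distrib)

text \<open>Splitting off the constant terms in \<tau> is the recursion behind both spanning and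
  independence. The higher part is written with \<open>frob q\<close> because \<tau> c = frob(c)
  \<tau>, so that one \<open>S\<close> comes out in front; as \<open>frob q\<close> is surjective,
  every coefficient has this form.\<close>

lemma comb_pCons:
  "comb (\<lambda>b. pCons (a b) (frob q (c b))) = (\<Sum>b\<in>B. monom (a b) b) + S (comb c)"
proof -
  have S_lin_eval: "lin_eval (const_coeffs (frob q p)) (\<lambda>i. S ((S ^^ i) x)) =
      S (lin_eval (const_coeffs p) (\<lambda>i. (S ^^ i) x))" for p x
  proof -
    have deg: "degree (const_coeffs p') = degree p'" for p' :: "'k poly"
      unfolding const_coeffs_def by (intro degree_map_poly) auto
    have cf: "coeff (const_coeffs p') i = [:coeff p' i:]" for p' :: "'k poly" and i
      by (simp add: const_coeffs_def coeff_map_poly)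
    show ?thesis
      by (simp add: lin_eval_def deg cf coeff_frob S_sum S_smult)
  qed
  show ?thesis
    by (simp add: comb_def const_coeffs_pCons lin_eval_pCons S_lin_eval S_sum sum.distrib smult_monom)
qed

text \<open>Reduction of the leading term. An exponent in \<open>B\<close> is removed by a monomial.
  Any other is the degree of some \<open>S x\<close>; since \<open>S\<close> acts on scalars by
  \<open>q\<close>-th powers, matching the leading coefficient takes a \<open>q\<close>-th root
  \<open>d\<close>, and as \<open>S\<close> raises degrees, the multiple of \<open>x\<close> by
  \<open>d\<close> is covered by induction.\<close>

lemma comb_surj: "degree y < n \<Longrightarrow> \<exists>c. y = comb c"
proof (induction n arbitrary: y)
  case (Suc n)
  \<comment> \<open>Asking for \<open>coeff z n = 0\<close> rather than for a degree below
    \<open>n\<close> also covers \<open>z = 0\<close> when \<open>n = 0\<close>.\<close>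
  have low: "\<exists>c. z = comb c" if "degree z \<le> n" "coeff z n = 0" for z
  proof (cases "z = 0")
    case True
    then show ?thesis using comb_0 by metis
  next
    case False
    then have "degree z \<noteq> n" using that(2) by auto
    then show ?thesis using Suc.IH that(1) by auto
  qed
  show ?case
  proof (cases "degree y < n")
    case False
    then have n: "degree y = n" using Suc.prems by simp
    show ?thesis
    proof (cases "n \<in> B")
      case True
      obtain c where c: "y - monom (coeff y n) n = comb c"
        using low[of "y - monom (coeff y n) n"] n degree_monom_le[of "coeff y n" n]
        by (auto intro: degree_diff_le)
      have "comb (\<lambda>b. pCons (if b = n then coeff y n else 0) (frob q 0)) =
          (\<Sum>b\<in>B. monom (if b = n then coeff y n else 0) b) + S (comb (\<lambda>_. 0))"
        by (rule comb_pCons)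
      also have "\<dots> = monom (coeff y n) n"
        using True finite_B by (simp add: comb_0 if_distrib[of "\<lambda>c. monom c _"] cong: if_cong)
      finally have "y = comb c + comb (\<lambda>b. pCons (if b = n then coeff y n else 0) (frob q 0))"
        using c by (simp add: diff_eq_eq)
      then show ?thesis using comb_add by metis
    next
      case False
      then obtain x where x: "x \<noteq> 0" "degree (S x) = n" using B_eq by auto
      then have "S x \<noteq> 0" using degree_S[of x] by auto
      then have lc: "coeff (S x) n \<noteq> 0" using x by auto
      obtain d where d: "d ^ q = coeff y n / coeff (S x) n" using power_q_surj by blast
      have "degree (smult d x) < n" using degree_S[OF x(1)] x(2) degree_smult_le[of d x] by simp
      then obtain c1 where c1: "smult d x = comb c1" using Suc.IH by blast
      have "degree (y - S (smult d x)) \<le> n"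
        using n x by (simp add: S_smult degree_diff_le)
      moreover have "coeff (y - S (smult d x)) n = 0" using d lc by (simp add: S_smult)
      ultimately obtain c2 where "y - S (smult d x) = comb c2" using low by blast
      then have "y = comb c2 + comb (\<lambda>b. pCons 0 (frob q (c1 b)))"
        unfolding comb_pCons by (simp add: c1 algebra_simps)
      then show ?thesis using comb_add by metis
    qed
  qed (use Suc.IH in blast)
qed simp

text \<open>\<open>n\<close> bounds the degrees in \<tau>. The constant terms give a polynomial with
  exponents in \<open>B\<close> only, whereas the nonzero values of \<open>S\<close> have degrees
  outside \<open>B\<close>; so the two parts vanish separately. As \<open>S\<close> is injective,
  the relation passes to coefficients of smaller degree.\<close>

lemma comb_eq_0:
  assumes "comb c = 0" "\<And>b i. b \<in> B \<Longrightarrow> i \<ge> n \<Longrightarrow> coeff (c b) i = 0" "b \<in> B"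
  shows "c b = 0"
  using assms
proof (induction n arbitrary: c b)
  case 0
  then show ?case by (simp add: poly_eq_iff)
next
  case (Suc n)
  have "\<exists>a c'. c b = pCons a (frob q c')" for b
    by (metis frob_surj pCons_cases)
  then obtain a c' where c: "\<And>b. c b = pCons (a b) (frob q (c' b))" by metis
  let ?P = "\<Sum>b\<in>B. monom (a b) b"
  have "c = (\<lambda>b. pCons (a b) (frob q (c' b)))" using c by blast
  then have sum0: "?P + S (comb c') = 0" using Suc.prems(1) comb_pCons[of a c'] by simp
  have coeff_P: "coeff ?P n = (if n \<in> B then a n else 0)" for n
    using finite_B by (simp add: coeff_sum coeff_monom)
  have P0: "?P = 0"
  proof (rule ccontr)
    assume "?P \<noteq> 0"
    then have "coeff ?P (degree ?P) \<noteq> 0" by simp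
    then have "degree ?P \<in> B" using coeff_P[of "degree ?P"] by presburger
    moreover have S_P: "S (- comb c') = ?P" unfolding S_minus using sum0 by (metis eq_neg_iff_add_eq_0)
    then have "- comb c' \<noteq> 0" using \<open>?P \<noteq> 0\<close> S_0 by metis
    then have "degree (S (- comb c')) \<notin> B" by (rule degree_S_notin_B)
    ultimately show False using S_P by simp
  qed
  then have "comb c' = 0" using sum0 degree_S[of "comb c'"] by auto
  moreover have "coeff (c' b) i = 0" if "b \<in> B" "i \<ge> n" for b i
  proof -
    have "coeff (c b) (Suc i) = 0" using Suc.prems(2) that by simp
    then show ?thesis using q_pos by (simp add: c coeff_frob)
  qed
  ultimately have "c' b = 0" using Suc.IH Suc.prems(3) by blast
  moreover have "a b = 0" using coeff_P[of b] P0 Suc.prems(3) by simp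
  ultimately show ?case by (simp add: c)
qed

lemma comb_ex1: "\<exists>!c. c \<in> B \<rightarrow>\<^sub>E UNIV \<and> y = comb c"
proof -
  obtain c where c: "y = comb c" using comb_surj by blast
  have restr: "comb (restrict c B) = comb c" for c
    by (simp add: comb_def)
  show ?thesis
  proof (rule ex1I[of _ "restrict c B"])
    show "restrict c B \<in> B \<rightarrow>\<^sub>E UNIV \<and> y = comb (restrict c B)" by (simp add: restr c)
    fix d assume d: "d \<in> B \<rightarrow>\<^sub>E UNIV \<and> y = comb d"
    have neg: "comb (\<lambda>b. - c b) = - comb c"
      using comb_add[of c "\<lambda>b. - c b"] by (simp add: comb_0 eq_neg_iff_add_eq_0 add.commute)
    have z: "comb (\<lambda>b. d b + - c b) = 0"
      unfolding comb_add neg using c d by simp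
    define n where "n = Suc (Max ((\<lambda>b. degree (d b + - c b)) ` B))"
    have "coeff (d b + - c b) i = 0" if "b \<in> B" "i \<ge> n" for b i
    proof -
      have "degree (d b + - c b) \<le> Max ((\<lambda>b. degree (d b + - c b)) ` B)"
        using that finite_B by (intro Max_ge) auto
      then show ?thesis using that by (intro coeff_eq_0) (simp add: n_def)
    qed
    then have "d b + - c b = 0" if "b \<in> B" for b
      using comb_eq_0[OF z, of n b] that by blast
    then show "d = restrict c B"
      using d by (auto simp: fun_eq_iff PiE_def extensional_def)
  qed
qed

end

section \<open>The module attached to a matrix\<close>

lemma carrier_ring_T [simp]: "carrier ring_T = UNIV"
  by (simp add: ring_of_type_algebra_def)

lemma carrier_ring_tau [simp]: "carrier (ring_tau q) = UNIV"
  by (simp add: ring_tau_def skew_poly_ring_def)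

lemma ring_T_tau_simps [simp]:
  "carrier (ring_T_tau q) = UNIV"
  "a \<oplus>\<^bsub>ring_T_tau q\<^esub> b = a + b"
  "\<one>\<^bsub>ring_T_tau q\<^esub> = 1"
  by (simp_all add: ring_T_tau_def skew_poly_ring_def)

lemma carrier_restrict_scalars [simp]: "carrier (restrict_scalars \<phi> M) = carrier M"
  by (simp add: restrict_scalars_def)

lemma smult_restrict_scalars [simp]: "a \<odot>\<^bsub>restrict_scalars \<phi> M\<^esub> x = \<phi> a \<odot>\<^bsub>M\<^esub> x"
  by (simp add: restrict_scalars_def)

lemma finsum_restrict_scalars [simp]: "finsum (restrict_scalars \<phi> M) f A = finsum M f A"
  by (simp add: finsum_def finprod_def restrict_scalars_def)

text \<open>Row vector convention: row l of \<open>Q\<close> holds the coordinates of the image of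
  the l-th basis vector, so \<tau> sends \<open>x\<close> to frob(x) Q. The value 0 from
  \<open>r\<close> on keeps the result in the carrier of \<open>matrix_module\<close>.\<close>

definition vec_tau :: "nat \<Rightarrow> nat \<Rightarrow> 'k::field poly mat \<Rightarrow> (nat \<Rightarrow> 'k poly) \<Rightarrow> nat \<Rightarrow> 'k poly" where
  "vec_tau q r Q x = (\<lambda>k. if k < r then \<Sum>l<r. frob q (x l) * Q $$ (l, k) else 0)"

definition matrix_module ::
  "nat \<Rightarrow> nat \<Rightarrow> 'k::field poly mat \<Rightarrow> ('k poly poly, nat \<Rightarrow> 'k poly) module" where
  "matrix_module q r Q =
     \<lparr>carrier = {x. \<forall>i\<ge>r. x i = 0}, monoid.mult = undefined, one = undefined,
      zero = (\<lambda>_. 0), add = (\<lambda>x y i. x i + y i),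
      module.smult = (\<lambda>a x i. lin_eval a (\<lambda>n. (vec_tau q r Q ^^ n) x i))\<rparr>"

lemma matrix_module_simps [simp]:
  "carrier (matrix_module q r Q) = {x. \<forall>i\<ge>r. x i = 0}"
  "\<zero>\<^bsub>matrix_module q r Q\<^esub> = (\<lambda>_. 0)"
  "x \<oplus>\<^bsub>matrix_module q r Q\<^esub> y = (\<lambda>i. x i + y i)"
  "a \<odot>\<^bsub>matrix_module q r Q\<^esub> x = (\<lambda>i. lin_eval a (\<lambda>n. (vec_tau q r Q ^^ n) x i))"
  by (simp_all add: matrix_module_def)

lemma abelian_group_matrix_module: "abelian_group (matrix_module q r Q)"
proof (rule abelian_groupI)
  fix x assume "x \<in> carrier (matrix_module q r Q)"
  then show "\<exists>y\<in>carrier (matrix_module q r Q). y \<oplus>\<^bsub>matrix_module q r Q\<^esub> x = \<zero>\<^bsub>matrix_module q r Q\<^esub>"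
    by (intro bexI[of _ "\<lambda>i. - x i"]) auto
qed (auto simp: add_ac)

lemma finsum_matrix_module:
  assumes "finite A" "\<And>i. i \<in> A \<Longrightarrow> f i \<in> carrier (matrix_module q r Q)"
  shows "(\<Oplus>\<^bsub>matrix_module q r Q\<^esub>i\<in>A. f i) = (\<lambda>k. \<Sum>i\<in>A. f i k)"
proof -
  interpret N: abelian_group "matrix_module q r Q" by (rule abelian_group_matrix_module)
  show ?thesis using assms
  proof (induction A rule: finite_induct)
    case empty
    then show ?case using N.finsum_empty by simp
  next
    case (insert a A)
    then have "f \<in> A \<rightarrow> carrier (matrix_module q r Q)" "f a \<in> carrier (matrix_module q r Q)" by blast+
    then show ?case using insert by (subst N.finsum_insert) simp_all
  qed
qed

definition std_vec :: "nat \<Rightarrow> nat \<Rightarrow> 'k::field poly" where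
  "std_vec i = (\<lambda>k. if k = i then 1 else 0)"

lemma smult_const_matrix_module: "[:p:] \<odot>\<^bsub>matrix_module q r Q\<^esub> x = (\<lambda>i. p * x i)"
  by (simp add: lin_eval_pCons)

lemma smult_tau_matrix_module: "tau \<odot>\<^bsub>matrix_module q r Q\<^esub> x = vec_tau q r Q x"
  by (simp add: tau_def lin_eval_pCons)

lemma sum_std_vec: "(\<lambda>k. \<Sum>i<r. c i * std_vec i k) = (\<lambda>k. if k < r then c k else 0)"
  by (auto simp: std_vec_def fun_eq_iff if_distrib[of "(*) _"] cong: if_cong)

lemma std_vec_finsum:
  "(\<Oplus>\<^bsub>over_T (matrix_module q r Q)\<^esub>i\<in>{..<r}. c i \<odot>\<^bsub>over_T (matrix_module q r Q)\<^esub> std_vec i) =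
     (\<lambda>k. if k < r then c k else 0)"
proof -
  let ?N = "matrix_module q r Q"
  have "(\<Oplus>\<^bsub>over_T ?N\<^esub>i\<in>{..<r}. c i \<odot>\<^bsub>over_T ?N\<^esub> std_vec i) =
      (\<Oplus>\<^bsub>?N\<^esub>i\<in>{..<r}. (\<lambda>k. c i * std_vec i k))"
    unfolding over_T_def finsum_restrict_scalars smult_restrict_scalars smult_const_matrix_module ..
  also have "\<dots> = (\<lambda>k. \<Sum>i<r. c i * std_vec i k)"
    by (rule finsum_matrix_module) (auto simp: std_vec_def)
  finally show ?thesis by (simp add: sum_std_vec)
qed

lemma module_basis_matrix_module: "module_basis ring_T (over_T (matrix_module q r Q)) r std_vec"
  unfolding module_basis_def std_vec_finsum
proof (intro conjI allI impI ballI)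
  fix i assume "i < r"
  then show "std_vec i \<in> carrier (over_T (matrix_module q r Q))"
    by (auto simp: over_T_def std_vec_def)
next
  fix x assume "x \<in> carrier (over_T (matrix_module q r Q))"
  then have x: "x i = 0" if "i \<ge> r" for i using that by (simp add: over_T_def)
  show "\<exists>!c. c \<in> {..<r} \<rightarrow>\<^sub>E carrier ring_T \<and> x = (\<lambda>k. if k < r then c k else 0)"
  proof (rule ex1I[of _ "restrict x {..<r}"])
    show "restrict x {..<r} \<in> {..<r} \<rightarrow>\<^sub>E carrier ring_T \<and> x = (\<lambda>k. if k < r then restrict x {..<r} k else 0)"
      using x by (auto simp: fun_eq_iff)
    fix c assume c: "c \<in> {..<r} \<rightarrow>\<^sub>E carrier ring_T \<and> x = (\<lambda>k. if k < r then c k else 0)"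
    then show "c = restrict x {..<r}" by (auto simp: fun_eq_iff PiE_def extensional_def)
  qed
qed

context bij_frobenius
begin

lemma vec_tau_sum:
  fixes Q :: "'k poly mat"
  shows "vec_tau q r Q (\<lambda>i. \<Sum>a\<in>A. p a * F a i) = (\<lambda>i. \<Sum>a\<in>A. frob q (p a) * vec_tau q r Q (F a) i)"
proof
  fix k
  show "vec_tau q r Q (\<lambda>i. \<Sum>a\<in>A. p a * F a i) k = (\<Sum>a\<in>A. frob q (p a) * vec_tau q r Q (F a) k)"
    by (simp add: vec_tau_def frob_sum frob_mult sum_distrib_left sum_distrib_right mult.assoc)
      (rule impI, rule sum.swap)
qed

lemma vec_tau_add:
  fixes Q :: "'k poly mat"
  shows "vec_tau q r Q (\<lambda>i. x i + y i) = (\<lambda>i. vec_tau q r Q x i + vec_tau q r Q y i)"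
  by (auto simp: vec_tau_def frob_add distrib_right sum.distrib)

lemma vec_tau_scale:
  fixes Q :: "'k poly mat"
  shows "vec_tau q r Q (\<lambda>i. p * x i) = (\<lambda>i. frob q p * vec_tau q r Q x i)"
  by (auto simp: vec_tau_def frob_mult sum_distrib_left mult.assoc)

lemma vec_tau_pow_sum:
  fixes Q :: "'k poly mat"
  shows "(vec_tau q r Q ^^ n) (\<lambda>i. \<Sum>a\<in>A. p a * F a i) =
    (\<lambda>i. \<Sum>a\<in>A. (frob q ^^ n) (p a) * (vec_tau q r Q ^^ n) (F a) i)"
  by (induction n) (simp_all add: vec_tau_sum)

lemma vec_tau_pow_add:
  fixes Q :: "'k poly mat"
  shows "(vec_tau q r Q ^^ n) (\<lambda>i. x i + y i) =
    (\<lambda>i. (vec_tau q r Q ^^ n) x i + (vec_tau q r Q ^^ n) y i)"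
  by (induction n) (simp_all add: vec_tau_add)

lemma vec_tau_pow_support:
  assumes "\<forall>i\<ge>r. x i = 0" "i \<ge> r"
  shows "(vec_tau q r Q ^^ n) x i = 0"
  using assms by (cases n) (auto simp: vec_tau_def)

text \<open>The ring axioms for the skew polynomials enter as a hypothesis; in the application they
  are part of the left module structure given on M.\<close>

lemma left_module_matrix_module:
  fixes Q :: "'k poly mat"
  assumes "Ring.ring (ring_T_tau q :: 'k poly poly ring)"
  shows "left_module (ring_T_tau q) (matrix_module q r Q)"
proof -
  interpret R: Ring.ring "ring_T_tau q :: 'k poly poly ring" by (rule assms)
  interpret N: abelian_group "matrix_module q r Q" by (rule abelian_group_matrix_module)
  show ?thesis
  proof
    fix a b :: "'k poly poly" and x y :: "nat \<Rightarrow> 'k poly"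
    assume x: "x \<in> carrier (matrix_module q r Q)"
    show "a \<odot>\<^bsub>matrix_module q r Q\<^esub> x \<in> carrier (matrix_module q r Q)"
      using x by (auto simp: vec_tau_pow_support lin_eval_def)
    show "(a \<oplus>\<^bsub>ring_T_tau q\<^esub> b) \<odot>\<^bsub>matrix_module q r Q\<^esub> x =
        a \<odot>\<^bsub>matrix_module q r Q\<^esub> x \<oplus>\<^bsub>matrix_module q r Q\<^esub> b \<odot>\<^bsub>matrix_module q r Q\<^esub> x"
      by (simp add: lin_eval_add)
    show "a \<odot>\<^bsub>matrix_module q r Q\<^esub> (x \<oplus>\<^bsub>matrix_module q r Q\<^esub> y) =
        a \<odot>\<^bsub>matrix_module q r Q\<^esub> x \<oplus>\<^bsub>matrix_module q r Q\<^esub> a \<odot>\<^bsub>matrix_module q r Q\<^esub> y"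
      by (simp add: vec_tau_pow_add lin_eval_def distrib_left sum.distrib)
    show "\<one>\<^bsub>ring_T_tau q\<^esub> \<odot>\<^bsub>matrix_module q r Q\<^esub> x = x"
      using smult_const_matrix_module[where p = 1 and x = x] by (simp add: one_pCons[where 'a = "'k poly", symmetric])
    show "(a \<otimes>\<^bsub>ring_T_tau q\<^esub> b) \<odot>\<^bsub>matrix_module q r Q\<^esub> x =
        a \<odot>\<^bsub>matrix_module q r Q\<^esub> (b \<odot>\<^bsub>matrix_module q r Q\<^esub> x)"
    proof
      fix k
      let ?t = "vec_tau q r Q"
      have "(a \<odot>\<^bsub>matrix_module q r Q\<^esub> (b \<odot>\<^bsub>matrix_module q r Q\<^esub> x)) k =
          (\<Sum>i\<le>degree a. coeff a i * (\<Sum>j\<le>degree b. (frob q ^^ i) (coeff b j) * (?t ^^ i) ((?t ^^ j) x) k))"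
        by (simp add: lin_eval_def vec_tau_pow_sum[where p = "coeff b" and F = "\<lambda>j. (?t ^^ j) x"])
      also have "\<dots> = (\<Sum>i\<le>degree a. \<Sum>j\<le>degree b.
          coeff a i * (frob q ^^ i) (coeff b j) * (?t ^^ (i + j)) x k)"
        by (simp add: sum_distrib_left mult.assoc funpow_add)
      also have "\<dots> = ((a \<otimes>\<^bsub>ring_T_tau q\<^esub> b) \<odot>\<^bsub>matrix_module q r Q\<^esub> x) k"
        by (simp add: ring_T_tau_def skew_poly_ring_def lin_eval_sum lin_eval_monom)
      finally show "((a \<otimes>\<^bsub>ring_T_tau q\<^esub> b) \<odot>\<^bsub>matrix_module q r Q\<^esub> x) k =
          (a \<odot>\<^bsub>matrix_module q r Q\<^esub> (b \<odot>\<^bsub>matrix_module q r Q\<^esub> x)) k" ..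
    qed
  qed
qed

lemma tau_matrix_matrix_module:
  fixes Q :: "'k poly mat"
  assumes "Q \<in> carrier_mat r r"
  shows "tau_matrix (matrix_module q r Q) r std_vec Q"
  unfolding tau_matrix_def std_vec_finsum smult_tau_matrix_module
  using assms module_basis_matrix_module
  by (auto simp: vec_tau_def std_vec_def fun_eq_iff if_distrib[of "frob q"] if_distrib[of "\<lambda>c. c * _"] cong: if_cong)

end

text \<open>The degree of an interleaved vector encodes its leading monomial \<open>T^k e_i\<close>, ordered by \<open>k\<close> and
  then \<open>i\<close>.\<close>

definition interleave :: "nat \<Rightarrow> (nat \<Rightarrow> 'k::field poly) \<Rightarrow> 'k poly" where
  "interleave r x = Abs_poly (\<lambda>n. coeff (x (n mod r)) (n div r))"

definition deinterleave :: "nat \<Rightarrow> 'k::field poly \<Rightarrow> nat \<Rightarrow> 'k poly" where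
  "deinterleave r p = (\<lambda>i. if i < r then Abs_poly (\<lambda>k. coeff p (k * r + i)) else 0)"

lemma coeff_interleave:
  assumes "r > 0"
  shows "coeff (interleave r x) n = coeff (x (n mod r)) (n div r)"
proof -
  define d where "d = Max ((\<lambda>i. degree (x i)) ` {..<r})"
  have "coeff (x (n mod r)) (n div r) = 0" if "n > d * r + r" for n
  proof -
    have "degree (x (n mod r)) \<le> d"
      unfolding d_def using assms by (intro Max_ge) auto
    moreover have "Suc d \<le> n div r"
      using that assms by (subst less_eq_div_iff_mult_less_eq) auto
    ultimately show ?thesis by (intro coeff_eq_0) auto
  qed
  then show ?thesis
    unfolding interleave_def by (subst coeff_Abs_poly) auto
qed

lemma coeff_deinterleave:
  assumes "i < r"
  shows "coeff (deinterleave r p i) k = coeff p (k * r + i)"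
proof -
  have "coeff p (k * r + i) = 0" if "k > degree p" for k
  proof (rule coeff_eq_0)
    have "k * 1 \<le> k * r" using assms by (intro mult_le_mono2) simp
    then show "degree p < k * r + i" using that by linarith
  qed
  then show ?thesis
    using assms unfolding deinterleave_def by (simp, subst coeff_Abs_poly) auto
qed

lemma interleave_deinterleave: "r > 0 \<Longrightarrow> interleave r (deinterleave r p) = p"
  by (simp add: poly_eq_iff coeff_interleave coeff_deinterleave)

lemma deinterleave_interleave:
  assumes "r > 0" "\<forall>i\<ge>r. x i = 0"
  shows "deinterleave r (interleave r x) = x"
proof
  fix i
  show "deinterleave r (interleave r x) i = x i"
  proof (cases "i < r")
    case True
    then show ?thesis by (simp add: poly_eq_iff coeff_interleave coeff_deinterleave)
  qed (use assms in \<open>simp add: deinterleave_def\<close>)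
qed

lemma interleave_eq_iff:
  assumes "r > 0" "\<forall>i\<ge>r. x i = 0" "\<forall>i\<ge>r. y i = 0"
  shows "interleave r x = interleave r y \<longleftrightarrow> x = y"
  using deinterleave_interleave[OF assms(1,2)] deinterleave_interleave[OF assms(1,3)] by metis

lemma interleave_add: "r > 0 \<Longrightarrow> interleave r (\<lambda>i. x i + y i) = interleave r x + interleave r y"
  by (simp add: poly_eq_iff coeff_interleave)

lemma interleave_sum:
  "r > 0 \<Longrightarrow> interleave r (\<lambda>i. \<Sum>a\<in>A. x a i) = (\<Sum>a\<in>A. interleave r (x a))"
  by (simp add: poly_eq_iff coeff_interleave coeff_sum)

lemma interleave_scale: "r > 0 \<Longrightarrow> interleave r (\<lambda>i. [:c:] * x i) = [:c:] * interleave r x"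
  by (simp add: poly_eq_iff coeff_interleave)

lemma deinterleave_add:
  "deinterleave r (p + p') = (\<lambda>i. deinterleave r p i + deinterleave r p' i)"
proof
  show "deinterleave r (p + p') i = deinterleave r p i + deinterleave r p' i" for i
    by (cases "i < r") (simp_all add: poly_eq_iff coeff_deinterleave, simp add: deinterleave_def)
qed

lemma deinterleave_smult: "deinterleave r (smult c p) = (\<lambda>i. [:c:] * deinterleave r p i)"
proof
  show "deinterleave r (smult c p) i = [:c:] * deinterleave r p i" for i
    by (cases "i < r") (simp_all add: poly_eq_iff coeff_deinterleave, simp add: deinterleave_def)
qed

lemma interleave_lin_eval_const_coeffs:
  assumes "r > 0"
  shows "interleave r (\<lambda>i. lin_eval (const_coeffs s) (\<lambda>n. F n i)) =
    lin_eval (const_coeffs s) (\<lambda>n. interleave r (F n))"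
proof -
  have cf: "coeff (const_coeffs s) i = [:coeff s i:]" for i
    by (simp add: const_coeffs_def coeff_map_poly)
  show ?thesis
    unfolding lin_eval_def cf
    by (simp only: interleave_sum[OF assms] interleave_scale[OF assms])
qed

section \<open>Dual matrices and freeness over the skew polynomials in \<tau>\<close>

text \<open>Q Q'^t = w = Q^t Q', the form of Q' = w (Q^t)^{-1} without denominators. The first
  identity drives the degree estimate, the second describes the image of \<tau>.\<close>

definition dual_matrices :: "nat \<Rightarrow> 'k::field poly \<Rightarrow> 'k poly mat \<Rightarrow> 'k poly mat \<Rightarrow> bool" where
  "dual_matrices r w Q Q' \<longleftrightarrow> Q \<in> carrier_mat r r \<and> Q' \<in> carrier_mat r r \<and>
     (\<forall>i<r. \<forall>j<r. (\<Sum>k<r. Q $$ (i, k) * Q' $$ (j, k)) = (if i = j then w else 0)) \<and>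
     (\<forall>i<r. \<forall>j<r. (\<Sum>k<r. Q $$ (k, i) * Q' $$ (k, j)) = (if i = j then w else 0))"

lemma ex1_PiE_reindex:
  assumes "bij_betw \<beta> I B" "\<exists>!c. c \<in> B \<rightarrow>\<^sub>E UNIV \<and> y = (\<Sum>b\<in>B. G (c b) b)"
  shows "\<exists>!c. c \<in> I \<rightarrow>\<^sub>E UNIV \<and> y = (\<Sum>i\<in>I. G (c i) (\<beta> i))"
proof -
  from assms(2) obtain c where c: "c \<in> B \<rightarrow>\<^sub>E UNIV" "y = (\<Sum>b\<in>B. G (c b) b)"
    and uniq: "\<And>d. d \<in> B \<rightarrow>\<^sub>E UNIV \<Longrightarrow> y = (\<Sum>b\<in>B. G (d b) b) \<Longrightarrow> d = c" by blast
  show ?thesis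
  proof (rule ex1I[of _ "\<lambda>i\<in>I. c (\<beta> i)"])
    show "(\<lambda>i\<in>I. c (\<beta> i)) \<in> I \<rightarrow>\<^sub>E UNIV \<and> y = (\<Sum>i\<in>I. G ((\<lambda>i\<in>I. c (\<beta> i)) i) (\<beta> i))"
      using c sum.reindex_bij_betw[OF assms(1), of "\<lambda>b. G (c b) b"] by simp
    fix d assume d: "d \<in> I \<rightarrow>\<^sub>E UNIV \<and> y = (\<Sum>i\<in>I. G (d i) (\<beta> i))"
    let ?e = "\<lambda>b\<in>B. d (the_inv_into I \<beta> b)"
    have inv: "the_inv_into I \<beta> (\<beta> i) = i" "\<beta> i \<in> B" if "i \<in> I" for i
      using that assms(1) by (auto simp: bij_betw_def the_inv_into_f_f)
    have "(\<Sum>b\<in>B. G (?e b) b) = (\<Sum>i\<in>I. G (?e (\<beta> i)) (\<beta> i))"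
      using sum.reindex_bij_betw[OF assms(1), of "\<lambda>b. G (?e b) b"] by simp
    also have "\<dots> = y" using d inv by simp
    finally have "?e = c" by (intro uniq) auto
    then have "c (\<beta> i) = d i" if "i \<in> I" for i using inv[OF that] by auto
    then show "d = (\<lambda>i\<in>I. c (\<beta> i))"
      using d by (auto simp: fun_eq_iff PiE_def extensional_def)
  qed
qed

context bij_frobenius
begin

text \<open>The preimage is frob^{-1}(x Q^t), which exists because K is perfect; \<tau> sends it to
  x Q^t Q' = w x.\<close>

lemma vec_tau_surj:
  fixes Q Q' :: "'k poly mat"
  assumes "dual_matrices r w Q Q'" "\<forall>i\<ge>r. x i = 0"
  shows "\<exists>y. (\<forall>i\<ge>r. y i = 0) \<and> vec_tau q r Q' y = (\<lambda>i. w * x i)"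
proof -
  have "\<exists>p. frob q p = (\<Sum>i<r. x i * Q $$ (l, i))" for l by (rule frob_surj)
  then obtain z where z: "\<And>l. frob q (z l) = (\<Sum>i<r. x i * Q $$ (l, i))" by metis
  define y where "y l = (if l < r then z l else 0)" for l
  have "vec_tau q r Q' y k = w * x k" for k
  proof (cases "k < r")
    case True
    have "vec_tau q r Q' y k = (\<Sum>l<r. \<Sum>i<r. x i * (Q $$ (l, i) * Q' $$ (l, k)))"
      using True by (simp add: vec_tau_def y_def z sum_distrib_right mult.assoc)
    also have "\<dots> = (\<Sum>i<r. x i * (\<Sum>l<r. Q $$ (l, i) * Q' $$ (l, k)))"
      by (subst sum.swap) (simp add: sum_distrib_left)
    also have "\<dots> = (\<Sum>i<r. x i * (if i = k then w else 0))"
      using assms(1) True by (intro sum.cong) (auto simp: dual_matrices_def)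
    also have "\<dots> = w * x k" using True by (simp add: if_distrib[of "(*) _"] cong: if_cong)
    finally show ?thesis .
  qed (use assms in \<open>simp add: vec_tau_def\<close>)
  then show ?thesis by (intro exI[of _ y]) (auto simp: y_def)
qed

text \<open>This is frob(x) Q' Q^t = w frob(x): multiplying by Q^t undoes \<tau> up to the Frobenius
  and the factor \<open>w\<close>.\<close>

lemma vec_tau_pairing:
  fixes Q Q' :: "'k poly mat"
  assumes "dual_matrices r w Q Q'" "i < r"
  shows "(\<Sum>k<r. vec_tau q r Q' x k * Q $$ (i, k)) = w * frob q (x i)"
proof -
  have "(\<Sum>k<r. vec_tau q r Q' x k * Q $$ (i, k)) =
      (\<Sum>k<r. \<Sum>l<r. frob q (x l) * (Q $$ (i, k) * Q' $$ (l, k)))"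
    by (simp add: vec_tau_def sum_distrib_left mult_ac)
  also have "\<dots> = (\<Sum>l<r. frob q (x l) * (\<Sum>k<r. Q $$ (i, k) * Q' $$ (l, k)))"
    by (subst sum.swap) (simp add: sum_distrib_left)
  also have "\<dots> = (\<Sum>l<r. frob q (x l) * (if i = l then w else 0))"
    using assms by (intro sum.cong) (auto simp: dual_matrices_def)
  also have "\<dots> = w * frob q (x i)"
    using assms(2) by (simp add: if_distrib[of "(*) _"] cong: if_cong)
  finally show ?thesis .
qed

text \<open>By the pairing, w frob(x_i) is a combination of the entries of \<tau> x with
  coefficients of degree below deg w. Entries of degree at most \<open>d\<close> could not produce
  its degree deg w + d.\<close>

lemma vec_tau_raises_degree:
  fixes Q Q' :: "'k poly mat"
  assumes dual: "dual_matrices r w Q Q'"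
    and deg: "\<And>i k. i < r \<Longrightarrow> k < r \<Longrightarrow> degree (Q $$ (i, k)) < degree w"
    and x: "\<And>i. i < r \<Longrightarrow> degree (x i) \<le> d" and i: "i < r" "x i \<noteq> 0" "degree (x i) = d"
  shows "\<exists>k<r. d < degree (vec_tau q r Q' x k)"
proof (rule ccontr)
  assume "\<not> ?thesis"
  then have le: "degree (vec_tau q r Q' x k) \<le> d" if "k < r" for k using that by (meson not_le)
  have w: "degree w > 0" using deg[OF i(1) i(1)] by simp
  have "degree (vec_tau q r Q' x k * Q $$ (i, k)) \<le> d + degree w - 1" if "k < r" for k
  proof -
    have "degree (vec_tau q r Q' x k * Q $$ (i, k)) \<le> degree (vec_tau q r Q' x k) + degree (Q $$ (i, k))"
      by (rule degree_mult_le)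
    then show ?thesis using le[OF that] deg[OF i(1) that] by linarith
  qed
  then have "degree (\<Sum>k<r. vec_tau q r Q' x k * Q $$ (i, k)) \<le> d + degree w - 1"
    by (intro degree_sum_le) auto
  then have "degree (w * frob q (x i)) \<le> d + degree w - 1"
    using vec_tau_pairing[OF dual i(1)] by simp
  moreover have "degree (w * frob q (x i)) = degree w + d"
    using w i by (subst degree_mult_eq) auto
  ultimately show False using w by linarith
qed

lemma free_over_tau_matrix_module:
  fixes Q Q' :: "'k poly mat"
  assumes dual: "dual_matrices r w Q Q'"
    and deg: "\<And>i k. i < r \<Longrightarrow> k < r \<Longrightarrow> degree (Q $$ (i, k)) < degree w"
  shows "free_fin_gen (ring_tau q) (over_tau (matrix_module q r Q'))"
proof (cases "r = 0")
  \<comment> \<open>Interleaving divides indices by \<open>r\<close>, so the zero module is treated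
    apart.\<close>
  case True
  interpret N: abelian_group "matrix_module q r Q'" by (rule abelian_group_matrix_module)
  have "module_basis (ring_tau q) (over_tau (matrix_module q r Q')) 0 (\<lambda>_ _. 0)"
    using True by (auto simp: module_basis_def over_tau_def N.finsum_empty[unfolded True])
  then show ?thesis by (auto simp: free_fin_gen_def)
next
  case False
  then have r: "r > 0" by simp
  let ?N = "matrix_module q r Q'"
  let ?t = "vec_tau q r Q'"
  define S where "S p = interleave r (?t (deinterleave r p))" for p
  define B where "B = {n. \<nexists>x. x \<noteq> 0 \<and> degree (S x) = n}"
  have S_interleave: "S (interleave r x) = interleave r (?t x)" if "\<forall>i\<ge>r. x i = 0" for x
    by (simp add: S_def deinterleave_interleave r that)
  have S_degree: "degree p < degree (S p)" if p: "p \<noteq> 0" for p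
  proof -
    define x where "x = deinterleave r p"
    have p_eq: "p = interleave r x" by (simp add: x_def interleave_deinterleave r)
    define I where "I = {i. i < r \<and> x i \<noteq> 0}"
    have "I \<noteq> {}"
    proof
      assume "I = {}"
      then have "p = 0" using r by (auto simp: p_eq poly_eq_iff coeff_interleave I_def)
      then show False using p by simp
    qed
    moreover have "finite I" by (simp add: I_def)
    ultimately have "Max ((\<lambda>i. degree (x i)) ` I) \<in> (\<lambda>i. degree (x i)) ` I"
      by (intro Max_in) auto
    then obtain i where i: "i \<in> I" "Max ((\<lambda>i. degree (x i)) ` I) = degree (x i)" by auto
    define d where "d = degree (x i)"
    have "degree (x l) \<le> d" if "l \<in> I" for l
      using Max_ge[of "(\<lambda>i. degree (x i)) ` I" "degree (x l)"] that i \<open>finite I\<close> by (simp add: d_def)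
    then have le: "degree (x l) \<le> d" if "l < r" for l
      using that by (cases "x l = 0") (auto simp: I_def)
    have "\<exists>k<r. d < degree (?t x k)"
    proof (rule vec_tau_raises_degree[OF dual])
      show "i < r" "x i \<noteq> 0" using i(1) by (auto simp: I_def)
    qed (simp_all add: deg le d_def[symmetric])
    then obtain k where k: "k < r" "d < degree (?t x k)" by blast
    \<comment> \<open>The monomials T^k e_i with k \<le> d sit at the indices k r + i, all below (d
      + 1) r. An entry of \<tau> x of degree above \<open>d\<close> reaches at least the index (d +
      1) r, whatever its position in the vector.\<close>
    have "degree p \<le> Suc d * r - 1"
    proof (rule degree_le, intro allI impI)
      fix n assume "Suc d * r - 1 < n"
      then have "Suc d \<le> n div r" using r by (subst less_eq_div_iff_mult_less_eq) auto
      then have "degree (x (n mod r)) < n div r" using le[of "n mod r"] r by auto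
      then show "coeff p n = 0" by (simp add: p_eq coeff_interleave r coeff_eq_0)
    qed
    also have "Suc d * r - 1 < degree (?t x k) * r + k"
    proof -
      have "Suc d * r \<le> degree (?t x k) * r" using k by (intro mult_le_mono1) simp
      moreover have "Suc d * r > 0" using r by simp
      ultimately show ?thesis by linarith
    qed
    also have "\<dots> \<le> degree (S p)"
    proof (rule le_degree)
      have "?t x k \<noteq> 0" using k by auto
      then show "coeff (S p) (degree (?t x k) * r + k) \<noteq> 0"
        using k r by (simp add: S_def x_def[symmetric] coeff_interleave)
    qed
    finally show ?thesis .
  qed
  \<comment> \<open>If n div r is at least deg w, then w T^(n div r - deg w) e_(n mod r) lies in the
    image of \<tau> and has leading index n.\<close>
  have "B \<subseteq> {..<degree w * r}"
  proof
    fix n assume n: "n \<in> B"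
    show "n \<in> {..<degree w * r}"
    proof (rule ccontr)
      assume "n \<notin> {..<degree w * r}"
      then have k: "degree w \<le> n div r" using r by (simp add: less_eq_div_iff_mult_less_eq)
      define u :: "'k poly" where "u = monom 1 (n div r - degree w)"
      have nr: "n mod r < r" using r by simp
      then have w0: "w \<noteq> 0" using deg[OF nr nr] by auto
      obtain y where y: "\<forall>i\<ge>r. y i = 0" "?t y = (\<lambda>i. w * (u * std_vec (n mod r) i))"
        using vec_tau_surj[OF dual, of "\<lambda>i. u * std_vec (n mod r) i"] nr by (auto simp: std_vec_def)
      have deg_wu: "degree (w * u) = n div r"
        using w0 k by (subst degree_mult_eq) (auto simp: u_def degree_monom_eq)
      have wu: "w * u \<noteq> 0" using w0 by (simp add: u_def)
      have cf: "coeff (S (interleave r y)) m = (if m mod r = n mod r then coeff (w * u) (m div r) else 0)" for m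
        by (simp add: S_interleave y coeff_interleave r std_vec_def)
      have "degree (S (interleave r y)) = n"
      proof (rule antisym)
        show "n \<le> degree (S (interleave r y))"
          using wu deg_wu by (intro le_degree) (metis cf leading_coeff_0_iff)
        show "degree (S (interleave r y)) \<le> n"
        proof (rule degree_le, intro allI impI)
          fix m assume "n < m"
          have "n div r < m div r" if "m mod r = n mod r"
            using that \<open>n < m\<close> by (metis div_le_mono div_mult_mod_eq less_le nat_less_le)
          then show "coeff (S (interleave r y)) m = 0" by (simp add: cf coeff_eq_0 deg_wu)
        qed
      qed
      moreover have "interleave r y \<noteq> 0"
      proof
        assume "interleave r y = 0"
        then have "y = (\<lambda>_. 0)"
          using deinterleave_interleave[OF r y(1)] deinterleave_smult[of r 0 "0 :: 'k poly"] by simp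
        then have "?t y (n mod r) = 0" by (simp add: vec_tau_def)
        then show False using y wu by (simp add: std_vec_def)
      qed
      ultimately show False using n by (auto simp: B_def)
    qed
  qed
  then have fin: "finite B" by (rule finite_subset) simp
  interpret S: degree_raising q ty S B
  proof
    fix p p' :: "'k poly" and c :: 'k
    show "S (p + p') = S p + S p'"
      by (simp add: S_def deinterleave_add vec_tau_add interleave_add r)
    have "frob q [:c:] = [:c ^ q:]" using q_pos by (simp add: frob_def map_poly_pCons)
    then show "S (smult c p) = smult (c ^ q) (S p)"
      unfolding S_def deinterleave_smult vec_tau_scale by (simp only: interleave_scale[OF r]) simp
  qed (use S_degree fin in \<open>auto simp: B_def\<close>)
  obtain \<beta> where \<beta>: "bij_betw \<beta> {..<card B} B"
    using ex_bij_betw_nat_finite[OF fin] by (auto simp: atLeast0LessThan)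
  let ?b = "\<lambda>i. deinterleave r (monom 1 (\<beta> i))"
  have supp: "\<forall>i\<ge>r. deinterleave r p i = 0" for p by (simp add: deinterleave_def)
  have S_pow: "interleave r ((?t ^^ n) (deinterleave r p)) = (S ^^ n) p" for n p
  proof (induction n)
    case (Suc n)
    have "\<forall>i\<ge>r. (?t ^^ n) (deinterleave r p) i = 0" using vec_tau_pow_support[OF supp] by blast
    from S_interleave[OF this] show ?case using Suc by simp
  qed (simp add: interleave_deinterleave r)
  have fs: "(\<Oplus>\<^bsub>over_tau ?N\<^esub>i\<in>{..<card B}. c i \<odot>\<^bsub>over_tau ?N\<^esub> ?b i) =
      (\<lambda>k. \<Sum>i<card B. lin_eval (const_coeffs (c i)) (\<lambda>n. (?t ^^ n) (?b i) k))" for c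
  proof -
    have "(\<Oplus>\<^bsub>over_tau ?N\<^esub>i\<in>{..<card B}. c i \<odot>\<^bsub>over_tau ?N\<^esub> ?b i) =
        (\<Oplus>\<^bsub>?N\<^esub>i\<in>{..<card B}. (\<lambda>k. lin_eval (const_coeffs (c i)) (\<lambda>n. (?t ^^ n) (?b i) k)))"
      by (simp add: over_tau_def const_coeffs_def)
    also have "\<dots> = (\<lambda>k. \<Sum>i<card B. lin_eval (const_coeffs (c i)) (\<lambda>n. (?t ^^ n) (?b i) k))"
      by (rule finsum_matrix_module) (auto simp: lin_eval_def vec_tau_pow_support[OF supp])
    finally show ?thesis .
  qed
  have "module_basis (ring_tau q) (over_tau ?N) (card B) ?b"
    unfolding module_basis_def fs
  proof (intro conjI ballI allI impI)
    show "?b i \<in> carrier (over_tau ?N)" for i by (simp add: over_tau_def supp)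
    fix x assume "x \<in> carrier (over_tau ?N)"
    then have x: "\<forall>i\<ge>r. x i = 0" by (simp add: over_tau_def)
    \<comment> \<open>The spanning equation is read between interleaved polynomials, the form to
      which \<open>S.comb_ex1\<close> applies.\<close>
    have eq: "x = (\<lambda>k. \<Sum>i<card B. lin_eval (const_coeffs (c i)) (\<lambda>n. (?t ^^ n) (?b i) k)) \<longleftrightarrow>
      interleave r x = (\<Sum>i<card B. lin_eval (const_coeffs (c i)) (\<lambda>n. (S ^^ n) (monom 1 (\<beta> i))))"
      (is "x = ?R \<longleftrightarrow> _ = ?R'") for c
    proof -
      have R': "interleave r ?R = ?R'"
        by (simp add: interleave_sum r interleave_lin_eval_const_coeffs S_pow)
      have "\<forall>i\<ge>r. ?R i = 0" by (auto simp: lin_eval_def vec_tau_pow_support[OF supp])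
      then have "x = ?R \<longleftrightarrow> interleave r x = interleave r ?R"
        by (rule interleave_eq_iff[OF r x, symmetric])
      then show ?thesis by (simp only: R')
    qed
    show "\<exists>!c. c \<in> {..<card B} \<rightarrow>\<^sub>E carrier (ring_tau q) \<and>
        x = (\<lambda>k. \<Sum>i<card B. lin_eval (const_coeffs (c i)) (\<lambda>n. (?t ^^ n) (?b i) k))"
      unfolding eq carrier_ring_tau
      by (rule ex1_PiE_reindex[OF \<beta>, of _ "\<lambda>s b. lin_eval (const_coeffs s) (\<lambda>n. (S ^^ n) (monom 1 b))"])
        (use S.comb_ex1 in \<open>simp add: S.comb_def\<close>)
  qed
  then show ?thesis by (auto simp: free_fin_gen_def)
qed

end

section \<open>Coordinates with respect to a basis over the polynomial ring in T\<close>

context bij_frobenius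
begin

text \<open>The coefficients 0 and 1 of \<open>tau\<close> are fixed by \<open>frob q\<close>, so
  right multiplication by it is a plain shift. This yields the recursion for the action along
  \<open>pCons\<close>.\<close>

lemma skew_mult_tau: "a \<otimes>\<^bsub>ring_T_tau q\<^esub> tau = pCons 0 (a :: 'k poly poly)"
proof -
  have [simp]: "(frob q ^^ i) 0 = (0 :: 'k poly)" "(frob q ^^ i) 1 = (1 :: 'k poly)" for i
    by (induction i) auto
  have sum_pCons: "(\<Sum>i\<in>A. pCons 0 (g i)) = pCons 0 (\<Sum>i\<in>A. g i)"
    for A :: "nat set" and g :: "nat \<Rightarrow> 'k poly poly"
    by (induction A rule: infinite_finite_induct) auto
  have "a \<otimes>\<^bsub>ring_T_tau q\<^esub> tau = (\<Sum>i\<le>degree a. monom (coeff a i) (Suc i))"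
    by (simp add: ring_T_tau_def skew_poly_ring_def tau_def)
  also have "\<dots> = pCons 0 (\<Sum>i\<le>degree a. monom (coeff a i) i)"
    unfolding monom_Suc by (rule sum_pCons)
  finally show ?thesis by (simp add: poly_as_sum_of_monoms)
qed

lemma tau_mult_const: "tau \<otimes>\<^bsub>ring_T_tau q\<^esub> [:p:] = [:frob q p:] \<otimes>\<^bsub>ring_T_tau q\<^esub> (tau :: 'k poly poly)"
  unfolding skew_mult_tau by (simp add: ring_T_tau_def skew_poly_ring_def tau_def monom_Suc monom_0)

lemma const_mult_const: "[:p:] \<otimes>\<^bsub>ring_T_tau q\<^esub> [:p':] = [:p * p' :: 'k poly:]"
  by (simp add: ring_T_tau_def skew_poly_ring_def monom_0)

end

locale skew_module = bij_frobenius q ty + left_module "ring_T_tau q" M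
  for q and ty :: "'k::field itself" and M :: "('k poly poly, 'm) module"
begin

lemma smult_in [simp, intro]: "x \<in> carrier M \<Longrightarrow> a \<odot>\<^bsub>M\<^esub> x \<in> carrier M"
  by (rule smult_closed) simp_all

lemma smult_add: "x \<in> carrier M \<Longrightarrow> (a + b) \<odot>\<^bsub>M\<^esub> x = a \<odot>\<^bsub>M\<^esub> x \<oplus>\<^bsub>M\<^esub> b \<odot>\<^bsub>M\<^esub> x"
  using smult_l_distr[of a b x] by simp

lemma smult_0_left: 
  assumes "x \<in> carrier M" shows "0 \<odot>\<^bsub>M\<^esub> x = \<zero>\<^bsub>M\<^esub>"
  using smult_add[OF assms, of 0 0] assms by (metis M.add.r_cancel_one' add_0 smult_in)

lemma smult_0_right: "a \<odot>\<^bsub>M\<^esub> \<zero>\<^bsub>M\<^esub> = \<zero>\<^bsub>M\<^esub>"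
  using smult_r_distr[of a "\<zero>\<^bsub>M\<^esub>" "\<zero>\<^bsub>M\<^esub>"]
  by (metis M.add.r_cancel_one' M.l_zero M.zero_closed UNIV_I ring_T_tau_simps(1) smult_in)

lemma smult_pCons:
  assumes "x \<in> carrier M"
  shows "pCons p a \<odot>\<^bsub>M\<^esub> x = [:p:] \<odot>\<^bsub>M\<^esub> x \<oplus>\<^bsub>M\<^esub> a \<odot>\<^bsub>M\<^esub> (tau \<odot>\<^bsub>M\<^esub> x)"
proof -
  have "pCons p a = [:p:] + a \<otimes>\<^bsub>ring_T_tau q\<^esub> tau" by (simp add: skew_mult_tau)
  then show ?thesis using assms smult_assoc[of a tau x] by (simp add: smult_add)
qed

lemma tau_smult_const:
  "x \<in> carrier M \<Longrightarrow> tau \<odot>\<^bsub>M\<^esub> ([:p:] \<odot>\<^bsub>M\<^esub> x) = [:frob q p:] \<odot>\<^bsub>M\<^esub> (tau \<odot>\<^bsub>M\<^esub> x)"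
  using smult_assoc[of tau "[:p:]" x] smult_assoc[of "[:frob q p:]" tau x]
  by (simp add: tau_mult_const)

lemma const_smult_const:
  "x \<in> carrier M \<Longrightarrow> [:p:] \<odot>\<^bsub>M\<^esub> ([:p':] \<odot>\<^bsub>M\<^esub> x) = [:p * p':] \<odot>\<^bsub>M\<^esub> x"
  using smult_assoc[of "[:p:]" "[:p':]" x] by (simp add: const_mult_const)

lemma smult_finsum:
  assumes "finite A" "\<And>i. i \<in> A \<Longrightarrow> g i \<in> carrier M"
  shows "a \<odot>\<^bsub>M\<^esub> (\<Oplus>\<^bsub>M\<^esub>i\<in>A. g i) = (\<Oplus>\<^bsub>M\<^esub>i\<in>A. a \<odot>\<^bsub>M\<^esub> g i)"
  using assms
proof (induction A rule: finite_induct)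
  case (insert i A)
  then have "g \<in> A \<rightarrow> carrier M" "g i \<in> carrier M" by auto
  then show ?case using insert smult_r_distr[of a "g i" "\<Oplus>\<^bsub>M\<^esub>i\<in>A. g i"]
    by (subst M.finsum_insert) (auto simp: M.finsum_insert M.finsum_closed)
qed (simp add: M.finsum_empty smult_0_right)

lemma over_T_finsum:
  "(\<Oplus>\<^bsub>over_T M\<^esub>i\<in>A. y i \<odot>\<^bsub>over_T M\<^esub> f i) = (\<Oplus>\<^bsub>M\<^esub>i\<in>A. [:y i:] \<odot>\<^bsub>M\<^esub> f i)"
  by (simp add: over_T_def)

end

text \<open>A basis repackaged as a coordinate isomorphism onto the functions vanishing from
  \<open>r\<close> on, the space that also carries \<open>matrix_module\<close>. Later arguments
  calculate with these vectors instead of sums in the module.\<close>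

locale framed_module = skew_module q ty M
  for q and ty :: "'k::field itself" and M :: "('k poly poly, 'm) module" +
  fixes r :: nat and f :: "nat \<Rightarrow> 'm" and c :: "'m \<Rightarrow> nat \<Rightarrow> 'k poly"
  assumes c_bij: "bij_betw c (carrier M) {y. \<forall>i\<ge>r. y i = 0}"
    and c_add: "x \<in> carrier M \<Longrightarrow> y \<in> carrier M \<Longrightarrow> c (x \<oplus>\<^bsub>M\<^esub> y) = (\<lambda>i. c x i + c y i)"
    and c_scale: "x \<in> carrier M \<Longrightarrow> c ([:p:] \<odot>\<^bsub>M\<^esub> x) = (\<lambda>i. p * c x i)"
    and f_in: "i < r \<Longrightarrow> f i \<in> carrier M"
    and c_f: "i < r \<Longrightarrow> c (f i) = std_vec i"
begin

lemma c_supp: "x \<in> carrier M \<Longrightarrow> i \<ge> r \<Longrightarrow> c x i = 0"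
  using c_bij by (auto simp: bij_betw_def)

lemma c_inj: "x \<in> carrier M \<Longrightarrow> y \<in> carrier M \<Longrightarrow> c x = c y \<Longrightarrow> x = y"
  using c_bij by (auto simp: bij_betw_def inj_on_def)

lemma c_surj:
  assumes "\<forall>i\<ge>r. y i = 0" obtains x where "x \<in> carrier M" "c x = y"
proof -
  have "y \<in> c ` carrier M" using assms c_bij by (simp add: bij_betw_def)
  then show thesis using that by blast
qed

lemma c_zero: "c \<zero>\<^bsub>M\<^esub> = (\<lambda>_. 0)"
  using c_scale[OF M.zero_closed, of 0] by (simp add: smult_0_left)

lemma c_finsum:
  assumes "finite A" "\<And>i. i \<in> A \<Longrightarrow> g i \<in> carrier M"
  shows "c (\<Oplus>\<^bsub>M\<^esub>i\<in>A. g i) = (\<lambda>k. \<Sum>i\<in>A. c (g i) k)"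
  using assms
proof (induction A rule: finite_induct)
  case (insert i A)
  then have "g \<in> A \<rightarrow> carrier M" "g i \<in> carrier M" by auto
  then show ?case using insert by (subst M.finsum_insert) (auto simp: c_add M.finsum_closed)
qed (simp add: M.finsum_empty c_zero)

lemma finsum_in: "(\<And>i. i < r \<Longrightarrow> g i \<in> carrier M) \<Longrightarrow> (\<Oplus>\<^bsub>M\<^esub>i\<in>{..<r}. g i) \<in> carrier M"
  by (rule M.finsum_closed) auto

lemma c_comb: "c (\<Oplus>\<^bsub>M\<^esub>i\<in>{..<r}. [:y i:] \<odot>\<^bsub>M\<^esub> f i) = (\<lambda>k. if k < r then y k else 0)"
proof -
  have "c (\<Oplus>\<^bsub>M\<^esub>i\<in>{..<r}. [:y i:] \<odot>\<^bsub>M\<^esub> f i) = (\<lambda>k. \<Sum>i<r. c ([:y i:] \<odot>\<^bsub>M\<^esub> f i) k)"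
    by (rule c_finsum) (auto simp: f_in)
  then show ?thesis by (simp add: c_scale f_in c_f sum_std_vec)
qed

lemma comb_c: "x \<in> carrier M \<Longrightarrow> x = (\<Oplus>\<^bsub>M\<^esub>i\<in>{..<r}. [:c x i:] \<odot>\<^bsub>M\<^esub> f i)"
  by (rule c_inj) (auto intro!: finsum_in simp: f_in c_comb c_supp fun_eq_iff)

lemma c_tau_sum:
  assumes x: "x \<in> carrier M"
  shows "c (tau \<odot>\<^bsub>M\<^esub> x) k = (\<Sum>i<r. frob q (c x i) * c (tau \<odot>\<^bsub>M\<^esub> f i) k)"
proof -
  have "tau \<odot>\<^bsub>M\<^esub> x = tau \<odot>\<^bsub>M\<^esub> (\<Oplus>\<^bsub>M\<^esub>i\<in>{..<r}. [:c x i:] \<odot>\<^bsub>M\<^esub> f i)"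
    using comb_c[OF x] by simp
  also have "\<dots> = (\<Oplus>\<^bsub>M\<^esub>i\<in>{..<r}. tau \<odot>\<^bsub>M\<^esub> ([:c x i:] \<odot>\<^bsub>M\<^esub> f i))"
    by (rule smult_finsum) (auto simp: f_in)
  also have "c \<dots> = (\<lambda>k. \<Sum>i<r. c (tau \<odot>\<^bsub>M\<^esub> ([:c x i:] \<odot>\<^bsub>M\<^esub> f i)) k)"
    by (rule c_finsum) (auto simp: f_in)
  finally have "c (tau \<odot>\<^bsub>M\<^esub> x) = (\<lambda>k. \<Sum>i<r. c (tau \<odot>\<^bsub>M\<^esub> ([:c x i:] \<odot>\<^bsub>M\<^esub> f i)) k)" .
  then show ?thesis by (simp add: tau_smult_const f_in c_scale)
qed

lemma c_tau:
  assumes Q: "tau_matrix M r f Q" and x: "x \<in> carrier M"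
  shows "c (tau \<odot>\<^bsub>M\<^esub> x) = vec_tau q r Q (c x)"
proof -
  have c_tau_f: "c (tau \<odot>\<^bsub>M\<^esub> f i) = (\<lambda>k. if k < r then Q $$ (i, k) else 0)" if "i < r" for i
  proof -
    have "tau \<odot>\<^bsub>M\<^esub> f i = (\<Oplus>\<^bsub>M\<^esub>j\<in>{..<r}. [:Q $$ (i, j):] \<odot>\<^bsub>M\<^esub> f j)"
      using Q that unfolding tau_matrix_def over_T_finsum by blast
    then show ?thesis by (simp add: c_comb)
  qed
  show ?thesis
    by (rule ext) (simp add: c_tau_sum[OF x] c_tau_f vec_tau_def)
qed

lemma tau_matrix_exists:
  assumes "module_basis ring_T (over_T M) r f"
  shows "tau_matrix M r f (mat r r (\<lambda>(i, j). c (tau \<odot>\<^bsub>M\<^esub> f i) j))"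
  unfolding tau_matrix_def over_T_finsum
proof (intro conjI allI impI)
  fix i assume i: "i < r"
  let ?Q = "mat r r (\<lambda>(i, j). c (tau \<odot>\<^bsub>M\<^esub> f i) j)"
  show "tau \<odot>\<^bsub>M\<^esub> f i = (\<Oplus>\<^bsub>M\<^esub>j\<in>{..<r}. [:?Q $$ (i, j):] \<odot>\<^bsub>M\<^esub> f j)"
    using i by (intro c_inj) (auto intro!: finsum_in simp: f_in c_comb c_supp fun_eq_iff)
qed (use assms in auto)

end

lemma (in skew_module) frame_exists:
  assumes basis: "module_basis ring_T (over_T M) r f"
  shows "\<exists>c. framed_module q M r f c"
proof -
  define V where "V = {y :: nat \<Rightarrow> 'k poly. \<forall>i\<ge>r. y i = 0}"
  define comb where "comb y = (\<Oplus>\<^bsub>M\<^esub>i\<in>{..<r}. [:y i:] \<odot>\<^bsub>M\<^esub> f i)" for y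
  have f_in: "f i \<in> carrier M" if "i < r" for i
    using basis that by (auto simp: module_basis_def over_T_def)
  have ex1: "\<exists>!y. y \<in> {..<r} \<rightarrow>\<^sub>E UNIV \<and> x = comb y" if "x \<in> carrier M" for x
    using basis that unfolding module_basis_def over_T_finsum comb_def by (simp add: over_T_def)
  have comb_in: "comb y \<in> carrier M" for y
    unfolding comb_def by (rule M.finsum_closed) (auto simp: f_in)
  have comb_cong: "comb y = comb y'" if "\<And>i. i < r \<Longrightarrow> y i = y' i" for y y'
    unfolding comb_def by (rule M.finsum_cong') (auto simp: f_in that)
  have comb_add: "comb (\<lambda>i. y i + y' i) = comb y \<oplus>\<^bsub>M\<^esub> comb y'" for y y'
  proof -
    have "comb (\<lambda>i. y i + y' i) = (\<Oplus>\<^bsub>M\<^esub>i\<in>{..<r}. [:y i:] \<odot>\<^bsub>M\<^esub> f i \<oplus>\<^bsub>M\<^esub> [:y' i:] \<odot>\<^bsub>M\<^esub> f i)"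
      unfolding comb_def by (rule M.finsum_cong') (auto simp: f_in smult_add[symmetric])
    also have "\<dots> = comb y \<oplus>\<^bsub>M\<^esub> comb y'"
      unfolding comb_def by (rule M.finsum_addf) (auto simp: f_in)
    finally show ?thesis .
  qed
  have comb_scale: "comb (\<lambda>i. p * y i) = [:p:] \<odot>\<^bsub>M\<^esub> comb y" for p y
  proof -
    have "[:p:] \<odot>\<^bsub>M\<^esub> comb y = (\<Oplus>\<^bsub>M\<^esub>i\<in>{..<r}. [:p:] \<odot>\<^bsub>M\<^esub> ([:y i:] \<odot>\<^bsub>M\<^esub> f i))"
      unfolding comb_def by (rule smult_finsum) (auto simp: f_in)
    also have "\<dots> = comb (\<lambda>i. p * y i)"
      unfolding comb_def by (rule M.finsum_cong') (auto simp: f_in const_smult_const)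
    finally show ?thesis ..
  qed
  have bij: "bij_betw comb V (carrier M)"
    unfolding bij_betw_def
  proof
    show "inj_on comb V"
    proof (rule inj_onI)
      fix y y' assume y: "y \<in> V" "y' \<in> V" and eq: "comb y = comb y'"
      \<comment> \<open>Uniqueness in \<open>module_basis\<close> concerns extensional functions,
        while \<open>V\<close> extends by 0; \<open>restrict\<close> mediates between the
        two.\<close>
      have "comb (restrict y {..<r}) = comb y" "comb (restrict y' {..<r}) = comb y"
        using eq comb_cong[of "restrict y {..<r}" y] comb_cong[of "restrict y' {..<r}" y'] by auto
      then have "restrict y {..<r} = restrict y' {..<r}"
        using ex1[OF comb_in[of y]] by (metis restrict_PiE_iff UNIV_I)
      then have "y i = y' i" if "i < r" for i using that by (metis lessThan_iff restrict_apply')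
      then show "y = y'" using y by (auto simp: V_def fun_eq_iff) (metis not_le)
    qed
    have "x \<in> comb ` V" if x: "x \<in> carrier M" for x
    proof -
      obtain y where "x = comb y" using ex1[OF x] by blast
      also have "\<dots> = comb (\<lambda>i. if i < r then y i else 0)" by (rule comb_cong) simp
      finally show ?thesis by (auto simp: V_def)
    qed
    then show "comb ` V = carrier M" using comb_in by blast
  qed
  define c where "c = the_inv_into V comb"
  have c_bij: "bij_betw c (carrier M) V"
    unfolding c_def by (rule bij_betw_the_inv_into[OF bij])
  have c_comb: "c (comb y) = y" if "y \<in> V" for y
    unfolding c_def using bij that by (simp add: bij_betw_def the_inv_into_f_f)
  have comb_c: "comb (c x) = x" if "x \<in> carrier M" for x
    unfolding c_def using bij that by (simp add: bij_betw_def f_the_inv_into_f)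
  have c_V: "c x \<in> V" if "x \<in> carrier M" for x using c_bij that by (auto simp: bij_betw_def)
  have "framed_module q M r f c"
  proof
    show "bij_betw c (carrier M) {y. \<forall>i\<ge>r. y i = 0}" using c_bij by (simp add: V_def)
    fix x y assume x: "x \<in> carrier M"
    show "c ([:p:] \<odot>\<^bsub>M\<^esub> x) = (\<lambda>i. p * c x i)" for p
    proof -
      have "(\<lambda>i. p * c x i) \<in> V" using c_V[OF x] by (simp add: V_def)
      from c_comb[OF this] show ?thesis using x by (simp add: comb_scale comb_c)
    qed
    assume y: "y \<in> carrier M"
    have "(\<lambda>i. c x i + c y i) \<in> V" using c_V[OF x] c_V[OF y] by (simp add: V_def)
    from c_comb[OF this] show "c (x \<oplus>\<^bsub>M\<^esub> y) = (\<lambda>i. c x i + c y i)"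
      using x y by (simp add: comb_add comb_c)
  next
    fix i assume i: "i < r"
    have "std_vec i \<in> V" using i by (auto simp: V_def std_vec_def)
    moreover have "comb (std_vec i) = f i"
    proof -
      have "comb (std_vec i) = (\<Oplus>\<^bsub>M\<^esub>j\<in>{..<r}. if i = j then f j else \<zero>\<^bsub>M\<^esub>)"
        unfolding comb_def
      proof (rule M.finsum_cong')
        show "[:std_vec i j:] \<odot>\<^bsub>M\<^esub> f j = (if i = j then f j else \<zero>\<^bsub>M\<^esub>)" if "j \<in> {..<r}" for j
          using that smult_one[of "f j"] f_in
          by (auto simp: std_vec_def smult_0_left one_pCons[where 'a = "'k poly", symmetric])
      qed (auto simp: f_in)
      also have "\<dots> = f i" using i f_in by (intro M.finsum_singleton) auto
      finally show ?thesis .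
    qed
    ultimately show "c (f i) = std_vec i" using c_comb by metis
  qed (rule f_in)
  then show ?thesis by blast
qed

section \<open>Dual matrices\<close>

lemma to_fract_sum: "to_fract (\<Sum>x\<in>A. g x) = (\<Sum>x\<in>A. to_fract (g x))"
  by (induction A rule: infinite_finite_induct) auto

lemma dual_matrices_scale:
  assumes "dual_matrices r w Q Q'"
  shows "dual_matrices r (p * w) Q (p \<cdot>\<^sub>m Q')"
proof -
  have "(\<Sum>k<r. Q $$ (i, k) * (p \<cdot>\<^sub>m Q') $$ (j, k)) = p * (\<Sum>k<r. Q $$ (i, k) * Q' $$ (j, k))"
    "(\<Sum>k<r. Q $$ (k, i) * (p \<cdot>\<^sub>m Q') $$ (k, j)) = p * (\<Sum>k<r. Q $$ (k, i) * Q' $$ (k, j))"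
    if "i < r" "j < r" for i j
    unfolding sum_distrib_left using assms that
    by (auto intro!: sum.cong simp: dual_matrices_def mult_ac)
  then show ?thesis
    using assms by (auto simp: dual_matrices_def)
qed

text \<open>C / w is a left inverse of Q over the field of fractions, and a left inverse of a square
  matrix over a field is also a right inverse. So C Q = w alone yields Q C = w.\<close>

lemma dual_matricesI_left_inverse:
  fixes Q C :: "'k::field poly mat"
  assumes Q: "Q \<in> carrier_mat r r" and C: "C \<in> carrier_mat r r" and w: "w \<noteq> 0"
    and CQ: "\<And>i j. i < r \<Longrightarrow> j < r \<Longrightarrow> (\<Sum>k<r. C $$ (i, k) * Q $$ (k, j)) = (if i = j then w else 0)"
  shows "dual_matrices r w Q (transpose_mat C)"
proof -
  define A where "A = map_mat to_fract Q"
  define B where "B = map_mat (\<lambda>x. to_fract x / to_fract w) C"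
  have AB: "A \<in> carrier_mat r r" "B \<in> carrier_mat r r" using Q C by (auto simp: A_def B_def)
  have "B * A = 1\<^sub>m r"
  proof (rule eq_matI)
    fix i j assume "i < dim_row (1\<^sub>m r :: 'k poly fract mat)" "j < dim_col (1\<^sub>m r :: 'k poly fract mat)"
    then have ij: "i < r" "j < r" by auto
    have "(B * A) $$ (i, j) = (\<Sum>k<r. to_fract (C $$ (i, k)) / to_fract w * to_fract (Q $$ (k, j)))"
      using Q C ij by (simp add: A_def B_def scalar_prod_def atLeast0LessThan)
    also have "\<dots> = to_fract (\<Sum>k<r. C $$ (i, k) * Q $$ (k, j)) / to_fract w"
      by (simp add: to_fract_sum sum_divide_distrib)
    also have "\<dots> = 1\<^sub>m r $$ (i, j)" using CQ[OF ij] ij w by simp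
    finally show "(B * A) $$ (i, j) = 1\<^sub>m r $$ (i, j)" .
  qed (use AB in auto)
  then have inv: "A * B = 1\<^sub>m r" using mat_mult_left_right_inverse[OF AB(2,1)] by blast
  have QC: "(\<Sum>k<r. Q $$ (i, k) * C $$ (k, j)) = (if i = j then w else 0)" if ij: "i < r" "j < r" for i j
  proof -
    have "(A * B) $$ (i, j) = (\<Sum>k<r. to_fract (Q $$ (i, k)) * (to_fract (C $$ (k, j)) / to_fract w))"
      using Q C ij by (simp add: A_def B_def scalar_prod_def atLeast0LessThan)
    also have "\<dots> = to_fract (\<Sum>k<r. Q $$ (i, k) * C $$ (k, j)) / to_fract w"
      by (simp add: to_fract_sum sum_divide_distrib)
    finally have "to_fract (\<Sum>k<r. Q $$ (i, k) * C $$ (k, j)) = to_fract w * 1\<^sub>m r $$ (i, j)"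
      using inv w by (simp add: field_simps)
    also have "\<dots> = to_fract (if i = j then w else 0)" using ij by simp
    finally show ?thesis by (simp only: to_fract_eq_iff)
  qed
  show ?thesis
    using Q C QC CQ by (auto simp: dual_matrices_def mult.commute)
qed

text \<open>The last condition forces R = Q' / w, so the quantifier disappears, and clearing
  denominators turns the two inverse conditions into the two identities of
  \<open>dual_matrices\<close>.\<close>

lemma dual_matrices_iff_inverse:
  fixes Q Q' :: "'k::field poly mat"
  assumes Q: "Q \<in> carrier_mat r r" and Q': "Q' \<in> carrier_mat r r" and w: "w \<noteq> 0"
  shows "dual_matrices r w Q Q' \<longleftrightarrow> (\<exists>R. R \<in> carrier_mat r r \<and>
    inverts_mat (map_mat to_fract (transpose_mat Q)) R \<and>
    inverts_mat R (map_mat to_fract (transpose_mat Q)) \<and>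
    map_mat to_fract Q' = to_fract w \<cdot>\<^sub>m R)"
proof -
  define R where "R = map_mat (\<lambda>x. to_fract x / to_fract w) Q'"
  have R: "R \<in> carrier_mat r r" using Q' by (simp add: R_def)
  have R_unique: "R' = R" if "R' \<in> carrier_mat r r" "map_mat to_fract Q' = to_fract w \<cdot>\<^sub>m R'" for R'
  proof (rule eq_matI)
    fix i j assume "i < dim_row R" "j < dim_col R"
    then have ij: "i < r" "j < r" using R by auto
    have "map_mat to_fract Q' $$ (i, j) = (to_fract w \<cdot>\<^sub>m R') $$ (i, j)" using that by simp
    then show "R' $$ (i, j) = R $$ (i, j)" using that(1) Q' ij w by (simp add: R_def)
  qed (use R that in auto)
  have R_eq: "map_mat to_fract Q' = to_fract w \<cdot>\<^sub>m R"
    using w by (intro eq_matI) (auto simp: R_def)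
  have eq1_iff: "to_fract x / to_fract w = (if i = j then 1 else 0) \<longleftrightarrow> x = (if i = j then w else 0)"
    for x i j using w by (auto simp: divide_eq_eq)
  have "inverts_mat (map_mat to_fract (transpose_mat Q)) R \<longleftrightarrow>
    (\<forall>i<r. \<forall>j<r. (map_mat to_fract (transpose_mat Q) * R) $$ (i, j) = (if i = j then 1 else 0))"
    unfolding inverts_mat_def using Q R by (auto simp: mat_eq_iff)
  also have "\<dots> \<longleftrightarrow> (\<forall>i<r. \<forall>j<r. (\<Sum>k<r. Q $$ (k, i) * Q' $$ (k, j)) = (if i = j then w else 0))"
  proof (intro all_cong)
    fix i j assume ij: "i < r" "j < r"
    have "(map_mat to_fract (transpose_mat Q) * R) $$ (i, j) =
        (\<Sum>k<r. to_fract (Q $$ (k, i)) * (to_fract (Q' $$ (k, j)) / to_fract w))"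
      using Q Q' ij by (simp add: R_def scalar_prod_def atLeast0LessThan)
    also have "\<dots> = to_fract (\<Sum>k<r. Q $$ (k, i) * Q' $$ (k, j)) / to_fract w"
      by (simp add: to_fract_sum sum_divide_distrib)
    finally show "((map_mat to_fract (transpose_mat Q) * R) $$ (i, j) = (if i = j then 1 else 0)) =
        ((\<Sum>k<r. Q $$ (k, i) * Q' $$ (k, j)) = (if i = j then w else 0))"
      by (simp only: eq1_iff)
  qed
  finally have inv1: "inverts_mat (map_mat to_fract (transpose_mat Q)) R \<longleftrightarrow>
    (\<forall>i<r. \<forall>j<r. (\<Sum>k<r. Q $$ (k, i) * Q' $$ (k, j)) = (if i = j then w else 0))" .
  have "inverts_mat R (map_mat to_fract (transpose_mat Q)) \<longleftrightarrow>
    (\<forall>j<r. \<forall>i<r. (R * map_mat to_fract (transpose_mat Q)) $$ (j, i) = (if i = j then 1 else 0))"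
    unfolding inverts_mat_def using Q R by (auto simp: mat_eq_iff)
  also have "\<dots> \<longleftrightarrow> (\<forall>j<r. \<forall>i<r. (\<Sum>k<r. Q $$ (i, k) * Q' $$ (j, k)) = (if i = j then w else 0))"
  proof (intro all_cong)
    fix i j assume ij: "i < r" "j < r"
    have "(R * map_mat to_fract (transpose_mat Q)) $$ (j, i) =
        (\<Sum>k<r. to_fract (Q' $$ (j, k)) / to_fract w * to_fract (Q $$ (i, k)))"
      using Q Q' ij by (simp add: R_def scalar_prod_def atLeast0LessThan)
    also have "\<dots> = to_fract (\<Sum>k<r. Q $$ (i, k) * Q' $$ (j, k)) / to_fract w"
      by (simp add: to_fract_sum sum_divide_distrib mult.commute)
    finally show "((R * map_mat to_fract (transpose_mat Q)) $$ (j, i) = (if i = j then 1 else 0)) =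
        ((\<Sum>k<r. Q $$ (i, k) * Q' $$ (j, k)) = (if i = j then w else 0))"
      by (simp only: eq1_iff)
  qed
  finally have inv2: "inverts_mat R (map_mat to_fract (transpose_mat Q)) \<longleftrightarrow>
    (\<forall>i<r. \<forall>j<r. (\<Sum>k<r. Q $$ (i, k) * Q' $$ (j, k)) = (if i = j then w else 0))" by blast
  have "dual_matrices r w Q Q' \<longleftrightarrow> inverts_mat (map_mat to_fract (transpose_mat Q)) R \<and>
      inverts_mat R (map_mat to_fract (transpose_mat Q))"
    unfolding inv1 inv2 dual_matrices_def using Q Q' by blast
  then show ?thesis using R R_eq R_unique by metis
qed

lemma T_minus_power: "T_minus \<theta> ^ n \<noteq> 0" "degree (T_minus \<theta> ^ n) = n"
  by (simp_all add: T_minus_def degree_power_eq)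

lemma is_mu_dual_iff:
  "is_mu_dual q \<theta> \<mu> M N \<longleftrightarrow> left_module (ring_T_tau q) N \<and>
    (\<exists>r f f' Q Q'. tau_matrix M r f Q \<and> tau_matrix N r f' Q' \<and> dual_matrices r (T_minus \<theta> ^ \<mu>) Q Q')"
proof -
  have "(\<exists>R. tau_matrix M r f Q \<and> tau_matrix N r f' Q' \<and> R \<in> carrier_mat r r \<and>
      inverts_mat (map_mat to_fract (transpose_mat Q)) R \<and>
      inverts_mat R (map_mat to_fract (transpose_mat Q)) \<and>
      map_mat to_fract Q' = to_fract (T_minus \<theta> ^ \<mu>) \<cdot>\<^sub>m R) \<longleftrightarrow>
    tau_matrix M r f Q \<and> tau_matrix N r f' Q' \<and> dual_matrices r (T_minus \<theta> ^ \<mu>) Q Q'" for r f f' Q Q'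
  proof (cases "tau_matrix M r f Q \<and> tau_matrix N r f' Q'")
    case True
    then have "Q \<in> carrier_mat r r" "Q' \<in> carrier_mat r r" by (auto simp: tau_matrix_def)
    from dual_matrices_iff_inverse[OF this T_minus_power(1)] True show ?thesis by blast
  qed blast
  then show ?thesis unfolding is_mu_dual_def by simp
qed

theorem (in bij_frobenius) mu_dual_exists:
  fixes M :: "('k poly poly, 'm) module"
  assumes M: "abelian_T_motive q \<theta> M"
  shows "\<exists>\<mu>0. \<forall>\<mu>\<ge>\<mu>0. \<exists>N :: ('k poly poly, nat \<Rightarrow> 'k poly) module.
    is_mu_dual q \<theta> \<mu> M N \<and> abelian_T_motive q \<theta> N"
proof -
  interpret skew_module q ty M
    using M bij_frobenius_axioms by (auto simp: skew_module_def abelian_T_motive_def)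
  obtain r f where basis: "module_basis ring_T (over_T M) r f"
    using M by (auto simp: abelian_T_motive_def free_fin_gen_def)
  obtain c where "framed_module q M r f c" using frame_exists[OF basis] by blast
  then interpret framed_module q ty M r f c .
  obtain Q where Q: "tau_matrix M r f Q" using tau_matrix_exists[OF basis] by blast
  then have Q_carrier: "Q \<in> carrier_mat r r" by (simp add: tau_matrix_def)
  obtain m where m: "\<And>x. x \<in> carrier M \<Longrightarrow> \<exists>y\<in>carrier M. [:T_minus \<theta> ^ m:] \<odot>\<^bsub>M\<^esub> x = tau \<odot>\<^bsub>M\<^esub> y"
    using M by (auto simp: abelian_T_motive_def over_T_def image_iff)
  define w where "w = T_minus \<theta> ^ m"
  have w: "w \<noteq> 0" unfolding w_def by (rule T_minus_power(1))
  have "\<exists>y. y \<in> carrier M \<and> [:w:] \<odot>\<^bsub>M\<^esub> f i = tau \<odot>\<^bsub>M\<^esub> y" if "i < r" for i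
    using m[OF f_in[OF that]] by (auto simp: w_def)
  then obtain y where y: "\<And>i. i < r \<Longrightarrow> y i \<in> carrier M \<and> [:w:] \<odot>\<^bsub>M\<^esub> f i = tau \<odot>\<^bsub>M\<^esub> y i"
    by metis
  \<comment> \<open>In coordinates, w f_i = \<tau> y_i reads w e_i = frob(c(y_i)) Q. Taking the
    vectors frob(c(y_i)) as rows gives C Q = w.\<close>
  define C where "C = mat r r (\<lambda>(i, l). frob q (c (y i) l))"
  have dual_m: "dual_matrices r w Q (transpose_mat C)"
  proof (rule dual_matricesI_left_inverse[OF Q_carrier])
    fix i j assume ij: "i < r" "j < r"
    have "vec_tau q r Q (c (y i)) j = w * std_vec i j"
      using c_tau[OF Q, of "y i"] y[OF ij(1)] c_scale[OF f_in[OF ij(1)], of w] c_f[OF ij(1)] by metis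
    then show "(\<Sum>k<r. C $$ (i, k) * Q $$ (k, j)) = (if i = j then w else 0)"
      using ij by (simp add: vec_tau_def C_def std_vec_def)
  qed (use w in \<open>auto simp: C_def\<close>)
  \<comment> \<open>The inserted 0 keeps \<open>Max\<close> meaningful when r = 0.\<close>
  define D where "D = Max (insert 0 ((\<lambda>(i, k). degree (Q $$ (i, k))) ` ({..<r} \<times> {..<r})))"
  have D: "degree (Q $$ (i, k)) \<le> D" if "i < r" "k < r" for i k
    unfolding D_def using that by (intro Max_ge) (auto intro!: image_eqI[of _ _ "(i, k)"])
  show ?thesis
  proof (rule exI[of _ "max m (Suc D)"], intro allI impI)
    fix \<mu> assume "\<mu> \<ge> max m (Suc D)"
    then have \<mu>: "\<mu> \<ge> m" "\<mu> > D" by auto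
    \<comment> \<open>The transpose of \<open>C\<close> serves the exponent \<open>m\<close>; the
      extra factor raises it to \<mu>.\<close>
    define Q' where "Q' = T_minus \<theta> ^ (\<mu> - m) \<cdot>\<^sub>m transpose_mat C"
    have dual: "dual_matrices r (T_minus \<theta> ^ \<mu>) Q Q'"
      using dual_matrices_scale[OF dual_m, of "T_minus \<theta> ^ (\<mu> - m)"] \<mu>(1)
      by (simp add: Q'_def w_def flip: power_add)
    let ?N = "matrix_module q r Q'"
    have Q'_carrier: "Q' \<in> carrier_mat r r" using dual by (simp add: dual_matrices_def)
    have lm: "left_module (ring_T_tau q) ?N"
      by (rule left_module_matrix_module) (rule R.ring_axioms)
    have "is_mu_dual q \<theta> \<mu> M ?N"
      unfolding is_mu_dual_iff using lm Q tau_matrix_matrix_module[OF Q'_carrier] dual by blast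
    moreover have "abelian_T_motive q \<theta> ?N"
      unfolding abelian_T_motive_def
    proof (intro conjI exI ballI)
      show "free_fin_gen ring_T (over_T ?N)"
        using module_basis_matrix_module unfolding free_fin_gen_def by blast
      show "free_fin_gen (ring_tau q) (over_tau ?N)"
        by (rule free_over_tau_matrix_module[OF dual]) (use D \<mu>(2) in \<open>fastforce simp: T_minus_power\<close>)
      fix x assume "x \<in> carrier ?N"
      then have x: "\<forall>i\<ge>r. x i = 0" by simp
      obtain z where "\<forall>i\<ge>r. z i = 0" "vec_tau q r Q' z = (\<lambda>i. T_minus \<theta> ^ \<mu> * x i)"
        using vec_tau_surj[OF dual x] by blast
      then show "T_minus \<theta> ^ \<mu> \<odot>\<^bsub>over_T ?N\<^esub> x \<in> (\<lambda>y. tau \<odot>\<^bsub>?N\<^esub> y) ` carrier ?N"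
        unfolding over_T_def smult_restrict_scalars smult_const_matrix_module smult_tau_matrix_module
        by (intro image_eqI[of _ _ z]) auto
    qed (rule lm)
    ultimately show "\<exists>N :: ('k poly poly, nat \<Rightarrow> 'k poly) module. is_mu_dual q \<theta> \<mu> M N \<and> abelian_T_motive q \<theta> N"
      by blast
  qed
qed

section \<open>Tensoring with the Carlitz motive\<close>

lemma carlitz_motive_simps [simp]:
  "carrier (carlitz_motive q \<theta>) = UNIV"
  "x \<oplus>\<^bsub>carlitz_motive q \<theta>\<^esub> y = x + y"
  "a \<odot>\<^bsub>carlitz_motive q \<theta>\<^esub> x = lin_eval a (\<lambda>n. ((\<lambda>p. frob q p * T_minus \<theta>) ^^ n) x)"
  by (simp_all add: carlitz_motive_def lin_eval_def)

text \<open>Here \<open>Q\<close> is the matrix of \<open>N\<close> itself; for a dual of M it is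
  instantiated with the dual matrix.\<close>

locale carlitz_twist = framed_module q ty N r f d
  for q and ty :: "'k::field itself" and N :: "('k poly poly, 'n) module" and r f d +
  fixes \<theta> :: 'k and Q :: "'k poly mat"
  assumes Q: "tau_matrix N r f Q"
begin

abbreviation F where "F \<equiv> pair_module q N (carlitz_motive q \<theta>)"
abbreviation K where "K \<equiv> bilinear_rels N (carlitz_motive q \<theta>)"
abbreviation pt where "pt \<equiv> pair_tau q N (carlitz_motive q \<theta>)"

text \<open>The rule \<tau>(x \<otimes> p) = \<tau> x \<otimes> frob(p) (T - \<theta>), seen after
  moving the second factor into the coordinates of the first.\<close>

definition twist_tau :: "(nat \<Rightarrow> 'k poly) \<Rightarrow> nat \<Rightarrow> 'k poly" where
  "twist_tau y = (\<lambda>k. T_minus \<theta> * vec_tau q r Q y k)"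

text \<open>The map \<open>x \<otimes> p \<mapsto> p x\<close> in coordinates; it identifies the tensor product with \<open>N\<close>.\<close>

definition contract :: "('n \<times> 'k poly \<Rightarrow> 'k poly) \<Rightarrow> nat \<Rightarrow> 'k poly" where
  "contract g = (\<lambda>k. \<Sum>z | g z \<noteq> 0. g z * snd z * d (fst z) k)"

text \<open>The nonempty fibres turn out to be exactly the cosets of \<open>K\<close>, so that
  elements of the tensor product are labelled by coordinate vectors.\<close>

definition fib :: "(nat \<Rightarrow> 'k poly) \<Rightarrow> ('n \<times> 'k poly \<Rightarrow> 'k poly) set" where
  "fib y = {g \<in> carrier F. contract g = y}"

lemma F_carrier: "g \<in> carrier F \<longleftrightarrow> finite {z. g z \<noteq> 0} \<and> (\<forall>z. g z \<noteq> 0 \<longrightarrow> fst z \<in> carrier N)"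
  by (auto simp: pair_module_def)

lemma F_add: "g \<oplus>\<^bsub>F\<^esub> h = (\<lambda>z. g z + h z)"
  by (simp add: pair_module_def)

lemma F_smult: "a \<odot>\<^bsub>F\<^esub> g = (\<lambda>z. lin_eval a (\<lambda>n. (pt ^^ n) g z))"
  by (simp add: pair_module_def lin_eval_def)

lemma F_zero_in: "(\<lambda>_. 0) \<in> carrier F"
  by (simp add: F_carrier)

lemma F_add_in:
  assumes "g \<in> carrier F" "h \<in> carrier F"
  shows "(\<lambda>z. g z + h z) \<in> carrier F"
proof -
  have "{z. g z + h z \<noteq> 0} \<subseteq> {z. g z \<noteq> 0} \<union> {z. h z \<noteq> 0}" by auto
  then have "finite {z. g z + h z \<noteq> 0}"
    using assms by (auto simp: F_carrier intro: finite_subset)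
  then show ?thesis using assms by (auto simp: F_carrier) (metis add_0)
qed

lemma F_scale_in:
  assumes "g \<in> carrier F"
  shows "(\<lambda>z. p * g z) \<in> carrier F"
proof -
  have "finite {z. p * g z \<noteq> 0}"
    by (rule finite_subset[of _ "{z. g z \<noteq> 0}"]) (use assms in \<open>auto simp: F_carrier\<close>)
  then show ?thesis using assms by (auto simp: F_carrier)
qed

lemma F_diff_in:
  assumes "g \<in> carrier F" "h \<in> carrier F"
  shows "(\<lambda>z. g z - h z) \<in> carrier F"
  using F_add_in[OF assms(1) F_scale_in[OF assms(2), of "-1"]] by simp

lemma F_single_in: "x \<in> carrier N \<Longrightarrow> single (x, p) \<in> carrier F"
  by (auto simp: F_carrier single_def)

lemma contract_eq:
  assumes "finite A" "{z. g z \<noteq> 0} \<subseteq> A"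
  shows "contract g k = (\<Sum>z\<in>A. g z * snd z * d (fst z) k)"
  unfolding contract_def using assms by (intro sum.mono_neutral_left) auto

lemma contract_add:
  assumes "g \<in> carrier F" "h \<in> carrier F"
  shows "contract (\<lambda>z. g z + h z) = (\<lambda>k. contract g k + contract h k)"
proof
  fix k
  let ?A = "{z. g z \<noteq> 0} \<union> {z. h z \<noteq> 0}"
  have fin: "finite ?A" using assms by (simp add: F_carrier)
  show "contract (\<lambda>z. g z + h z) k = contract g k + contract h k"
    using contract_eq[OF fin, of g k] contract_eq[OF fin, of h k]
      contract_eq[OF fin, of "\<lambda>z. g z + h z" k]
    by (force simp: sum.distrib algebra_simps)
qed

lemma contract_scale:
  assumes "g \<in> carrier F"
  shows "contract (\<lambda>z. p * g z) = (\<lambda>k. p * contract g k)"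
proof
  fix k
  have fin: "finite {z. g z \<noteq> 0}" using assms by (simp add: F_carrier)
  show "contract (\<lambda>z. p * g z) k = p * contract g k"
    using contract_eq[OF fin, of "\<lambda>z. p * g z" k]
    by (force simp: contract_def sum_distrib_left mult.assoc)
qed

lemma contract_diff:
  assumes "g \<in> carrier F" "h \<in> carrier F"
  shows "contract (\<lambda>z. g z - h z) = (\<lambda>k. contract g k - contract h k)"
  using contract_add[OF assms(1) F_scale_in[OF assms(2), of "-1"]] contract_scale[OF assms(2), of "-1"]
  by simp

lemma contract_zero: "contract (\<lambda>_. 0) = (\<lambda>_. 0)"
  by (simp add: contract_def)

lemma contract_single: "contract (single (x, p)) = (\<lambda>k. p * d x k)"
  by (rule ext) (simp add: contract_eq[of "{(x, p)}"] single_def)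

lemma contract_supp: "g \<in> carrier F \<Longrightarrow> k \<ge> r \<Longrightarrow> contract g k = 0"
  by (auto simp: contract_def F_carrier c_supp intro!: sum.neutral)

lemma F_sum_in:
  assumes "finite I" "\<And>i. i \<in> I \<Longrightarrow> G i \<in> carrier F"
  shows "(\<lambda>z. \<Sum>i\<in>I. p i * G i z) \<in> carrier F"
  using assms
proof (induction I rule: finite_induct)
  case (insert i I)
  then have "(\<lambda>z. p i * G i z + (\<Sum>i\<in>I. p i * G i z)) \<in> carrier F"
    by (intro F_add_in F_scale_in) auto
  then show ?case using insert by simp
qed (simp add: F_zero_in)

lemma contract_sum:
  assumes "finite I" "\<And>i. i \<in> I \<Longrightarrow> G i \<in> carrier F"
  shows "contract (\<lambda>z. \<Sum>i\<in>I. p i * G i z) = (\<lambda>k. \<Sum>i\<in>I. p i * contract (G i) k)"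
  using assms
proof (induction I rule: finite_induct)
  case (insert i I)
  have "contract (\<lambda>z. p i * G i z + (\<Sum>i\<in>I. p i * G i z)) =
      (\<lambda>k. p i * contract (G i) k + (\<Sum>i\<in>I. p i * contract (G i) k))"
    using insert contract_add[OF F_scale_in F_sum_in[of I], of "G i" G "p i" p]
    by (simp add: contract_scale)
  then show ?case using insert by simp
qed (simp add: contract_zero)

lemma rel_contract: "g \<in> K \<Longrightarrow> g \<in> carrier F \<and> contract g = (\<lambda>_. 0)"
proof (induction rule: bilinear_rels.induct)
  case (add_left x x' y)
  then show ?case
    by (simp add: F_diff_in F_single_in contract_diff contract_single c_add distrib_left)
next
  case (add_right x y y')
  then show ?case
    by (simp add: F_diff_in F_single_in contract_diff contract_single distrib_right)
next
  case (scale_left x y p)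
  then show ?case
    by (simp add: F_diff_in F_single_in F_scale_in contract_diff contract_single contract_scale
        over_T_def c_scale algebra_simps)
next
  case (scale_right x y p)
  then show ?case
    by (simp add: F_diff_in F_single_in F_scale_in contract_diff contract_single contract_scale
        over_T_def lin_eval_pCons algebra_simps)
qed (simp_all add: F_zero_in F_add_in F_scale_in contract_zero contract_add contract_scale)

lemma rel_diff: "g \<in> K \<Longrightarrow> h \<in> K \<Longrightarrow> (\<lambda>z. g z - h z) \<in> K"
  using bilinear_rels.add[OF _ bilinear_rels.scale[of h N "carlitz_motive q \<theta>" "-1"]] by fastforce

lemma rel_single_zero: "single (\<zero>\<^bsub>N\<^esub>, 1) \<in> K"
  using bilinear_rels.scale_left[of "\<zero>\<^bsub>N\<^esub>" N 1 "carlitz_motive q \<theta>" 0]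
  by (simp add: over_T_def smult_0_left)

text \<open>The second factor is generated by 1, so modulo the relations each p (x \<otimes> s)
  becomes (p s x) \<otimes> 1, and such terms add up in the first factor. Hence the kernel of
  \<open>contract\<close> cannot exceed \<open>K\<close>. The set \<open>A\<close> merely contains
  the support, to allow induction on it.\<close>

lemma rel_pure:
  assumes "finite A" "g \<in> carrier F" "{z. g z \<noteq> 0} \<subseteq> A"
  shows "\<exists>x\<in>carrier N. (\<lambda>z. g z - single (x, 1) z) \<in> K"
  using assms
proof (induction A arbitrary: g rule: finite_induct)
  case empty
  then have "g = (\<lambda>_. 0)" by auto
  then show ?case
    using rel_diff[OF bilinear_rels.zero rel_single_zero] by auto
next
  case (insert a A)
  show ?case
  proof (cases "g a = 0")
    case True
    then show ?thesis using insert by (intro insert.IH) auto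
  next
    case False
    obtain x s where a: "a = (x, s)" by (cases a)
    have x: "x \<in> carrier N" using False insert.prems a by (auto simp: F_carrier)
    define p where "p = g a"
    define g' where "g' = (\<lambda>z. g z - p * single (x, s) z)"
    have "g' \<in> carrier F" unfolding g'_def
      using insert.prems x by (intro F_diff_in F_scale_in F_single_in)
    moreover have "{z. g' z \<noteq> 0} \<subseteq> A"
      using insert.prems by (auto simp: g'_def p_def a single_def split: if_splits)
    ultimately obtain x' where x': "x' \<in> carrier N" and k1: "(\<lambda>z. g' z - single (x', 1) z) \<in> K"
      using insert.IH by blast
    let ?y = "[:p * s:] \<odot>\<^bsub>N\<^esub> x"
    have y: "?y \<in> carrier N" using x by blast
    have k2: "(\<lambda>z. p * (single (x, s) z - s * single (x, 1) z)) \<in> K"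
      using bilinear_rels.scale[OF bilinear_rels.scale_right[OF x, of 1 "carlitz_motive q \<theta>" s]]
      by (simp add: over_T_def lin_eval_pCons)
    have k3: "(\<lambda>z. single (?y, 1) z - (p * s) * single (x, 1) z) \<in> K"
      using bilinear_rels.scale_left[OF x, of 1 "carlitz_motive q \<theta>" "p * s"]
      by (simp add: over_T_def)
    have k4: "(\<lambda>z. single (x' \<oplus>\<^bsub>N\<^esub> ?y, 1) z - single (x', 1) z - single (?y, 1) z) \<in> K"
      using bilinear_rels.add_left[OF x' y, of 1 "carlitz_motive q \<theta>"] by simp
    \<comment> \<open>\<open>k2\<close> and \<open>k3\<close> rewrite the removed term as
      \<open>?y\<close> \<otimes> 1, and \<open>k4\<close> merges it with x' \<otimes> 1.\<close>
    have "(\<lambda>z. g z - single (x' \<oplus>\<^bsub>N\<^esub> ?y, 1) z) =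
        (\<lambda>z. ((g' z - single (x', 1) z) + p * (single (x, s) z - s * single (x, 1) z)) -
          ((single (?y, 1) z - (p * s) * single (x, 1) z) +
           (single (x' \<oplus>\<^bsub>N\<^esub> ?y, 1) z - single (x', 1) z - single (?y, 1) z)))"
      by (simp add: g'_def algebra_simps)
    also have "\<dots> \<in> K"
      by (intro rel_diff bilinear_rels.add[OF k1 k2] bilinear_rels.add[OF k3 k4])
    finally show ?thesis using x' y by (intro bexI[of _ "x' \<oplus>\<^bsub>N\<^esub> ?y"]) auto
  qed
qed

lemma K_eq: "K = fib (\<lambda>_. 0)"
proof
  show "K \<subseteq> fib (\<lambda>_. 0)" using rel_contract by (auto simp: fib_def)
  show "fib (\<lambda>_. 0) \<subseteq> K"
  proof
    fix g assume "g \<in> fib (\<lambda>_. 0)"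
    then have g: "g \<in> carrier F" "contract g = (\<lambda>_. 0)" by (auto simp: fib_def)
    obtain x where x: "x \<in> carrier N" and k: "(\<lambda>z. g z - single (x, 1) z) \<in> K"
      using rel_pure[of "{z. g z \<noteq> 0}" g] g(1) by (auto simp: F_carrier)
    have "contract (\<lambda>z. g z - single (x, 1) z) = (\<lambda>_. 0)" using rel_contract[OF k] by blast
    then have "d x = (\<lambda>_. 0)"
      using g x by (simp add: contract_diff F_single_in contract_single fun_eq_iff)
    then have "x = \<zero>\<^bsub>N\<^esub>" using c_inj[OF x M.zero_closed] by (simp add: c_zero)
    then show "g \<in> K" using bilinear_rels.add[OF k] rel_single_zero by fastforce
  qed
qed

lemma fib_nonempty:
  assumes "\<forall>k\<ge>r. y k = 0"
  obtains g where "g \<in> fib y"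
proof -
  obtain x where "x \<in> carrier N" "d x = y" using c_surj[OF assms] .
  then have "single (x, 1) \<in> fib y" by (simp add: fib_def F_single_in contract_single)
  then show thesis by (rule that)
qed

lemma coset_eq_fib:
  assumes g: "g \<in> carrier F"
  shows "K +>\<^bsub>F\<^esub> g = fib (contract g)"
proof
  show "K +>\<^bsub>F\<^esub> g \<subseteq> fib (contract g)"
    using g by (auto simp: K_eq a_r_coset_def' F_add fib_def F_add_in contract_add)
  show "fib (contract g) \<subseteq> K +>\<^bsub>F\<^esub> g"
  proof
    fix h assume h: "h \<in> fib (contract g)"
    then have "(\<lambda>z. h z - g z) \<in> K"
      using g by (auto simp: K_eq fib_def F_diff_in contract_diff)
    then show "h \<in> K +>\<^bsub>F\<^esub> g"
      by (auto simp: a_r_coset_def' F_add intro!: bexI[of _ "\<lambda>z. h z - g z"])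
  qed
qed

lemma carrier_tensor:
  "carrier (tensor_motive q N (carlitz_motive q \<theta>)) = fib ` {y. \<forall>k\<ge>r. y k = 0}"
proof -
  have "carrier (tensor_motive q N (carlitz_motive q \<theta>)) = (\<lambda>g. fib (contract g)) ` carrier F"
    by (auto simp: tensor_motive_def Let_def A_RCOSETS_def' coset_eq_fib)
  also have "\<dots> = fib ` (contract ` carrier F)" by auto
  also have "contract ` carrier F = {y. \<forall>k\<ge>r. y k = 0}"
  proof
    show "contract ` carrier F \<subseteq> {y. \<forall>k\<ge>r. y k = 0}" using contract_supp by auto
    show "{y. \<forall>k\<ge>r. y k = 0} \<subseteq> contract ` carrier F"
    proof
      fix y assume "y \<in> {y :: nat \<Rightarrow> 'k poly. \<forall>k\<ge>r. y k = 0}"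
      then obtain g where "g \<in> fib y" using fib_nonempty[of y] by blast
      then show "y \<in> contract ` carrier F" by (auto simp: fib_def)
    qed
  qed
  finally show ?thesis .
qed

lemma fib_inj: "inj_on fib {y. \<forall>k\<ge>r. y k = 0}"
proof (rule inj_onI)
  fix y y' assume "y \<in> {y. \<forall>k\<ge>r. y k = 0}" "fib y = fib y'"
  moreover then obtain g where "g \<in> fib y" using fib_nonempty[of y] by blast
  ultimately show "y = y'" by (auto simp: fib_def)
qed

lemma tensor_add:
  assumes y: "\<forall>k\<ge>r. y k = 0"
  shows "fib y \<oplus>\<^bsub>tensor_motive q N (carlitz_motive q \<theta>)\<^esub> fib y' = fib (\<lambda>k. y k + y' k)"
proof -
  have "fib y <+>\<^bsub>F\<^esub> fib y' = fib (\<lambda>k. y k + y' k)"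
  proof
    show "fib y <+>\<^bsub>F\<^esub> fib y' \<subseteq> fib (\<lambda>k. y k + y' k)"
      by (auto simp: set_add_def' F_add fib_def F_add_in contract_add)
    show "fib (\<lambda>k. y k + y' k) \<subseteq> fib y <+>\<^bsub>F\<^esub> fib y'"
    proof
      fix h assume h: "h \<in> fib (\<lambda>k. y k + y' k)"
      obtain g where g: "g \<in> fib y" using fib_nonempty[OF y] .
      have "(\<lambda>z. h z - g z) \<in> fib y'"
        using g h by (auto simp: fib_def F_diff_in contract_diff)
      then show "h \<in> fib y <+>\<^bsub>F\<^esub> fib y'"
        unfolding set_add_def' F_add using g
        by (intro UN_I[of g] UN_I[of "\<lambda>z. h z - g z"]) auto
    qed
  qed
  then show ?thesis by (simp add: tensor_motive_def Let_def)
qed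

lemma contract_pair_tau:
  assumes g: "g \<in> carrier F"
  shows "pt g \<in> carrier F \<and> contract (pt g) = twist_tau (contract g)"
proof -
  let ?A = "{z. g z \<noteq> 0}"
  let ?t = "\<lambda>z. (tau \<odot>\<^bsub>N\<^esub> fst z, frob q (snd z) * T_minus \<theta>)"
  have fin: "finite ?A" using g by (simp add: F_carrier)
  have pt: "pt g w = (\<Sum>z\<in>{z \<in> ?A. ?t z = w}. frob q (g z))" for w
    by (simp add: pair_tau_def tau_def lin_eval_pCons)
  have supp: "{w. pt g w \<noteq> 0} \<subseteq> ?t ` ?A"
  proof
    fix w assume "w \<in> {w. pt g w \<noteq> 0}"
    then have nz: "pt g w \<noteq> 0" by simp
    have "{z \<in> ?A. ?t z = w} \<noteq> {}"
    proof
      assume "{z \<in> ?A. ?t z = w} = {}"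
      then have "pt g w = 0" unfolding pt by (simp only: sum.empty)
      then show False using nz by simp
    qed
    then show "w \<in> ?t ` ?A" by blast
  qed
  have "pt g \<in> carrier F"
    unfolding F_carrier
  proof (intro conjI allI impI)
    show "finite {w. pt g w \<noteq> 0}" using supp fin by (meson finite_imageI finite_subset)
    fix w assume "pt g w \<noteq> 0"
    then obtain z where "g z \<noteq> 0" "w = ?t z" using supp by auto
    moreover from this have "fst z \<in> carrier N" using g unfolding F_carrier by blast
    ultimately show "fst w \<in> carrier N" by simp
  qed
  moreover have "contract (pt g) k = twist_tau (contract g) k" for k
  proof -
    \<comment> \<open>Different pairs may share an image and their coefficients may cancel, so the
      support of \<open>pt g\<close> can be smaller than the image of \<open>?A\<close>. The sum
      therefore runs over the whole image and is regrouped by fibres.\<close>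
    have "contract (pt g) k = (\<Sum>w\<in>?t ` ?A. pt g w * snd w * d (fst w) k)"
      using supp fin by (intro contract_eq) auto
    also have "\<dots> = (\<Sum>w\<in>?t ` ?A. \<Sum>z\<in>{z \<in> ?A. ?t z = w}. frob q (g z) * snd (?t z) * d (fst (?t z)) k)"
      unfolding pt sum_distrib_right by (intro sum.cong refl) auto
    also have "\<dots> = (\<Sum>z\<in>?A. frob q (g z) * snd (?t z) * d (fst (?t z)) k)"
      by (rule sum.image_gen[OF fin, symmetric])
    also have "\<dots> = (\<Sum>z\<in>?A. T_minus \<theta> * (frob q (g z * snd z) * vec_tau q r Q (d (fst z)) k))"
    proof (rule sum.cong[OF refl])
      fix z assume "z \<in> ?A"
      then have "fst z \<in> carrier N" using g unfolding F_carrier by blast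
      then show "frob q (g z) * snd (?t z) * d (fst (?t z)) k =
          T_minus \<theta> * (frob q (g z * snd z) * vec_tau q r Q (d (fst z)) k)"
        by (simp add: c_tau[OF Q] frob_mult mult_ac)
    qed
    also have "\<dots> = twist_tau (contract g) k"
      by (simp add: twist_tau_def contract_def vec_tau_sum sum_distrib_left)
    finally show ?thesis .
  qed
  ultimately show ?thesis by blast
qed

lemma contract_pair_tau_pow:
  assumes g: "g \<in> carrier F"
  shows "(pt ^^ n) g \<in> carrier F \<and> contract ((pt ^^ n) g) = (twist_tau ^^ n) (contract g)"
  by (induction n) (use g contract_pair_tau in auto)

lemma tensor_smult:
  assumes y: "\<forall>k\<ge>r. y k = 0"
  shows "a \<odot>\<^bsub>tensor_motive q N (carlitz_motive q \<theta>)\<^esub> fib y =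
    fib (\<lambda>k. lin_eval a (\<lambda>n. (twist_tau ^^ n) y k))"
proof -
  have "K +>\<^bsub>F\<^esub> (a \<odot>\<^bsub>F\<^esub> g) = fib (\<lambda>k. lin_eval a (\<lambda>n. (twist_tau ^^ n) y k))" if "g \<in> fib y" for g
  proof -
    have g: "g \<in> carrier F" "contract g = y" using that by (auto simp: fib_def)
    have "a \<odot>\<^bsub>F\<^esub> g \<in> carrier F"
      unfolding F_smult lin_eval_def using g(1) by (intro F_sum_in) (auto simp: contract_pair_tau_pow)
    moreover have "contract (a \<odot>\<^bsub>F\<^esub> g) = (\<lambda>k. lin_eval a (\<lambda>n. (twist_tau ^^ n) y k))"
      unfolding F_smult lin_eval_def using g
      by (subst contract_sum) (auto simp: contract_pair_tau_pow)
    ultimately show ?thesis by (simp add: coset_eq_fib)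
  qed
  \<comment> \<open>The union of equal sets collapses to that set only over a nonempty index
    set.\<close>
  moreover obtain g where "g \<in> fib y" using fib_nonempty[OF y] .
  ultimately have "(\<Union>g\<in>fib y. K +>\<^bsub>F\<^esub> (a \<odot>\<^bsub>F\<^esub> g)) = fib (\<lambda>k. lin_eval a (\<lambda>n. (twist_tau ^^ n) y k))"
    by auto
  then show ?thesis by (simp add: tensor_motive_def Let_def)
qed

text \<open>Compatibility with addition, K[T] and \<tau> extends to all skew polynomials by
  induction along \<open>pCons\<close>; the vector stays arbitrary because the step applies the
  induction hypothesis to \<tau> x.\<close>

lemma isomorphic_tensor:
  fixes N' :: "('k poly poly, 'n1) module"
  assumes N': "left_module (ring_T_tau q) N'"
    and u_bij: "bij_betw u (carrier N') {y. \<forall>k\<ge>r. y k = 0}"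
    and u_add: "\<And>x y. x \<in> carrier N' \<Longrightarrow> y \<in> carrier N' \<Longrightarrow> u (x \<oplus>\<^bsub>N'\<^esub> y) = (\<lambda>k. u x k + u y k)"
    and u_scale: "\<And>p x. x \<in> carrier N' \<Longrightarrow> u ([:p:] \<odot>\<^bsub>N'\<^esub> x) = (\<lambda>k. p * u x k)"
    and u_tau: "\<And>x. x \<in> carrier N' \<Longrightarrow> u (tau \<odot>\<^bsub>N'\<^esub> x) = twist_tau (u x)"
  shows "left_module_isomorphic (ring_T_tau q) N' (tensor_motive q N (carlitz_motive q \<theta>))"
proof -
  interpret N': skew_module q ty N'
    using N' bij_frobenius_axioms by (simp add: skew_module_def)
  have u_supp: "\<forall>k\<ge>r. u x k = 0" if "x \<in> carrier N'" for x
    using u_bij that by (auto simp: bij_betw_def)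
  have u_smult: "u (a \<odot>\<^bsub>N'\<^esub> x) = (\<lambda>k. lin_eval a (\<lambda>n. (twist_tau ^^ n) (u x) k))"
    if "x \<in> carrier N'" for a x
    using that
  proof (induction a arbitrary: x)
    case 0
    then show ?case using u_scale[of x 0] by simp
  next
    case (pCons p a)
    note x = pCons.prems
    have "u (pCons p a \<odot>\<^bsub>N'\<^esub> x) = (\<lambda>k. p * u x k + u (a \<odot>\<^bsub>N'\<^esub> (tau \<odot>\<^bsub>N'\<^esub> x)) k)"
      using x by (subst N'.smult_pCons) (simp_all add: u_add u_scale)
    also have "u (a \<odot>\<^bsub>N'\<^esub> (tau \<odot>\<^bsub>N'\<^esub> x)) = (\<lambda>k. lin_eval a (\<lambda>n. (twist_tau ^^ n) (twist_tau (u x)) k))"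
      using pCons.IH[of "tau \<odot>\<^bsub>N'\<^esub> x"] x by (simp add: u_tau)
    finally show ?case by (simp add: lin_eval_pCons funpow_Suc_right del: funpow.simps(2))
  qed
  show ?thesis
    unfolding left_module_isomorphic_def
  proof (intro exI[of _ "\<lambda>x. fib (u x)"] conjI ballI)
    show "bij_betw (\<lambda>x. fib (u x)) (carrier N') (carrier (tensor_motive q N (carlitz_motive q \<theta>)))"
      unfolding carrier_tensor
      using bij_betw_trans[OF u_bij inj_on_imp_bij_betw[OF fib_inj]] by (simp add: comp_def)
  qed (simp_all add: u_add u_smult tensor_add tensor_smult u_supp)
qed

end

section \<open>Comparison of duals for consecutive exponents\<close>

context bij_frobenius
begin

text \<open>The left side is frob(a) P P'^t frob(b)^t, and P P'^t = w.\<close>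

lemma vec_tau_dual_pairing:
  fixes P P' :: "'k poly mat"
  assumes "dual_matrices r w P P'"
  shows "(\<Sum>k<r. vec_tau q r P a k * vec_tau q r P' b k) = w * frob q (\<Sum>k<r. a k * b k)"
proof -
  have "(\<Sum>k<r. vec_tau q r P a k * vec_tau q r P' b k) =
      (\<Sum>k<r. \<Sum>l<r. frob q (a l) * (vec_tau q r P' b k * P $$ (l, k)))"
    by (simp add: vec_tau_def[of q r P] sum_distrib_left mult_ac)
  also have "\<dots> = (\<Sum>l<r. frob q (a l) * (\<Sum>k<r. vec_tau q r P' b k * P $$ (l, k)))"
    by (subst sum.swap) (simp add: sum_distrib_left)
  also have "\<dots> = (\<Sum>l<r. frob q (a l) * (w * frob q (b l)))"
    by (intro sum.cong) (simp_all add: vec_tau_pairing[OF assms])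
  finally show ?thesis by (simp add: frob_sum frob_mult sum_distrib_left mult_ac)
qed

lemma frame_of_tau_matrix:
  fixes M :: "('k poly poly, 'm) module"
  assumes "left_module (ring_T_tau q) M" "tau_matrix M r f Q"
  shows "\<exists>c. framed_module q M r f c"
proof -
  interpret skew_module q ty M
    using assms(1) bij_frobenius_axioms by (simp add: skew_module_def)
  show ?thesis using assms(2) by (intro frame_exists) (simp add: tau_matrix_def)
qed

lemma coord_change:
  assumes "framed_module q M r f c" "framed_module q M r' f' c'" "x \<in> carrier M"
  shows "c' x k = (\<Sum>i<r. c x i * c' (f i) (k :: nat) :: 'k poly)"
proof -
  interpret c: framed_module q ty M r f c by (rule assms)
  interpret c': framed_module q ty M r' f' c' by (rule assms)
  have "c' x = c' (\<Oplus>\<^bsub>M\<^esub>i\<in>{..<r}. [:c x i:] \<odot>\<^bsub>M\<^esub> f i)" using c.comb_c[OF assms(3)] by simp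
  also have "\<dots> = (\<lambda>k. \<Sum>i<r. c' ([:c x i:] \<odot>\<^bsub>M\<^esub> f i) k)"
    by (rule c'.c_finsum) (auto simp: c.f_in)
  finally show ?thesis by (simp add: c'.c_scale c.f_in)
qed

text \<open>
  Both duals are paired with \<open>M\<close>, with \<open>\<langle>\<tau> m, \<tau> n\<rangle> = (T - \<theta>)^\<mu> \<sigma>\<langle>m, n\<rangle>\<close>. The map that preserves
  these pairings is bijective, and it turns \<open>\<tau>\<close> into \<open>(T - \<theta>) \<tau>\<close> because of the two exponents.
\<close>

theorem mu_dual_Suc_isomorphic:
  fixes M :: "('k poly poly, 'm) module" and N :: "('k poly poly, 'n) module"
    and N' :: "('k poly poly, 'n1) module"
  assumes M: "left_module (ring_T_tau q) M"
    and N: "is_mu_dual q \<theta> \<mu> M N" and N': "is_mu_dual q \<theta> (\<mu> + 1) M N'"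
  shows "left_module_isomorphic (ring_T_tau q) N' (tensor_motive q N (carlitz_motive q \<theta>))"
proof -
  define w where "w = T_minus \<theta> ^ \<mu>"
  have w: "w \<noteq> 0" unfolding w_def by (rule T_minus_power(1))
  obtain r f f' Q Q' where Q: "tau_matrix M r f Q" and Q': "tau_matrix N r f' Q'"
    and dual: "dual_matrices r w Q Q'" and lmN: "left_module (ring_T_tau q) N"
    using N unfolding is_mu_dual_iff w_def by blast
  obtain s g g' P P' where P: "tau_matrix M s g P" and P': "tau_matrix N' s g' P'"
    and dual': "dual_matrices s (T_minus \<theta> * w) P P'" and lmN': "left_module (ring_T_tau q) N'"
    using N' unfolding is_mu_dual_iff w_def by auto
  obtain c where c_frame: "framed_module q M r f c"
    using frame_of_tau_matrix[OF M Q] by blast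
  then interpret c: framed_module q ty M r f c .
  obtain c' where c'_frame: "framed_module q M s g c'"
    using frame_of_tau_matrix[OF M P] by blast
  then interpret c': framed_module q ty M s g c' .
  obtain d where "framed_module q N r f' d" using frame_of_tau_matrix[OF lmN Q'] by blast
  then interpret d: framed_module q ty N r f' d .
  interpret N: carlitz_twist q ty N r f' d \<theta> Q' by unfold_locales (rule Q')
  obtain e where "framed_module q N' s g' e" using frame_of_tau_matrix[OF lmN' P'] by blast
  then interpret e: framed_module q ty N' s g' e .

  \<comment> \<open>The base change on M, transposed: \<open>A\<close> carries coordinates on N' to
    coordinates on N, and \<open>B\<close> goes back. They are made so that the pairings with M
    agree in both coordinate systems, which shows them mutually inverse without knowing r = s
    beforehand.\<close>
  define A where "A y = (\<lambda>i. if i < r then \<Sum>k<s. c' (f i) k * y k else 0)" for y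
  define B where "B y = (\<lambda>k. if k < s then \<Sum>i<r. c (g k) i * y i else 0)" for y
  have pairing: "(\<Sum>i<r. c x i * A y i) = (\<Sum>k<s. c' x k * y k)" if "x \<in> carrier M" for x y
  proof -
    have "(\<Sum>i<r. c x i * A y i) = (\<Sum>i<r. \<Sum>k<s. c x i * c' (f i) k * y k)"
      by (simp add: A_def sum_distrib_left mult.assoc)
    also have "\<dots> = (\<Sum>k<s. (\<Sum>i<r. c x i * c' (f i) k) * y k)"
      by (subst sum.swap) (simp add: sum_distrib_right)
    finally show ?thesis by (simp flip: coord_change[OF c_frame c'_frame that])
  qed
  have pairing': "(\<Sum>k<s. c' x k * B y k) = (\<Sum>i<r. c x i * y i)" if "x \<in> carrier M" for x y
  proof -
    have "(\<Sum>k<s. c' x k * B y k) = (\<Sum>k<s. \<Sum>i<r. c' x k * c (g k) i * y i)"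
      by (simp add: B_def sum_distrib_left mult.assoc)
    also have "\<dots> = (\<Sum>i<r. (\<Sum>k<s. c' x k * c (g k) i) * y i)"
      by (subst sum.swap) (simp add: sum_distrib_right)
    finally show ?thesis by (simp flip: coord_change[OF c'_frame c_frame that])
  qed
  have std_sum: "(\<Sum>k<n. std_vec i k * y k) = y i" if "i < n" for i n and y :: "nat \<Rightarrow> 'k poly"
    using that by (simp add: std_vec_def if_distrib[of "\<lambda>x. x * _"] cong: if_cong)
  \<comment> \<open>Pairing with the basis vectors of M reads off single coordinates.\<close>
  have AB: "A (B y) = y" if "\<forall>i\<ge>r. y i = 0" for y
  proof
    fix i
    show "A (B y) i = y i"
    proof (cases "i < r")
      case True
      then show ?thesis using pairing'[OF c.f_in[OF True], of y]
        by (simp add: A_def c.c_f std_sum)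
    qed (use that in \<open>simp add: A_def\<close>)
  qed
  have BA: "B (A y) = y" if "\<forall>k\<ge>s. y k = 0" for y
  proof
    fix k
    show "B (A y) k = y k"
    proof (cases "k < s")
      case True
      then show ?thesis using pairing[OF c'.f_in[OF True], of y]
        by (simp add: B_def c'.c_f std_sum)
    qed (use that in \<open>simp add: B_def\<close>)
  qed
  have A_bij: "bij_betw A {y. \<forall>k\<ge>s. y k = 0} {y. \<forall>i\<ge>r. y i = 0}"
    by (rule bij_betw_byWitness[of _ B]) (auto simp: AB BA, auto simp: A_def B_def)
  have A_tau: "A (vec_tau q s P' y) = N.twist_tau (A y)" for y
  proof -
    \<comment> \<open>The failure of compatibility with \<tau>. Its pairing with \<tau> f_j, whose
      coordinates are row j of \<open>Q\<close>, is 0: the first term gives (T - \<theta>) w frob(A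
      y j) by duality on N', the second gives the same by duality on N and the factor T - \<theta>
      of the twist.\<close>
    define z where "z i = A (vec_tau q s P' y) i - N.twist_tau (A y) i" for i
    have Qz: "(\<Sum>i<r. Q $$ (j, i) * z i) = 0" if j: "j < r" for j
    proof -
      have fj: "f j \<in> carrier M" by (rule c.f_in[OF j])
      have Q_row: "c (tau \<odot>\<^bsub>M\<^esub> f j) i = Q $$ (j, i)" if "i < r" for i
        using that j by (simp add: c.c_tau[OF Q fj] c.c_f vec_tau_def std_vec_def
            if_distrib[of "frob q"] if_distrib[of "\<lambda>x. x * _"] cong: if_cong)
      have "(\<Sum>i<r. Q $$ (j, i) * A (vec_tau q s P' y) i) =
          (\<Sum>i<r. c (tau \<odot>\<^bsub>M\<^esub> f j) i * A (vec_tau q s P' y) i)"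
        by (simp add: Q_row)
      also have "\<dots> = (\<Sum>k<s. c' (tau \<odot>\<^bsub>M\<^esub> f j) k * vec_tau q s P' y k)"
        by (rule pairing) (use fj in auto)
      also have "\<dots> = T_minus \<theta> * w * frob q (A y j)"
        using j by (simp add: c'.c_tau[OF P fj] vec_tau_dual_pairing[OF dual'] A_def)
      also have "\<dots> = T_minus \<theta> * (\<Sum>i<r. vec_tau q r Q' (A y) i * Q $$ (j, i))"
        by (simp add: vec_tau_pairing[OF dual j] mult.assoc)
      also have "\<dots> = (\<Sum>i<r. Q $$ (j, i) * N.twist_tau (A y) i)"
        by (simp add: N.twist_tau_def sum_distrib_left mult_ac)
      finally show ?thesis by (simp add: z_def right_diff_distrib sum_subtractf)
    qed
    have "z k = 0" if k: "k < r" for k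
    proof -
      \<comment> \<open>Q z = 0 is cancelled by multiplying with Q'^t, since Q'^t Q = w and w is
        nonzero.\<close>
      have "0 = (\<Sum>j<r. Q' $$ (j, k) * (\<Sum>i<r. Q $$ (j, i) * z i))" by (simp add: Qz)
      also have "\<dots> = (\<Sum>j<r. \<Sum>i<r. z i * (Q $$ (j, i) * Q' $$ (j, k)))"
        by (simp add: sum_distrib_left mult_ac)
      also have "\<dots> = (\<Sum>i<r. z i * (\<Sum>j<r. Q $$ (j, i) * Q' $$ (j, k)))"
        by (subst sum.swap) (simp add: sum_distrib_left)
      also have "\<dots> = (\<Sum>i<r. z i * (if i = k then w else 0))"
        using dual k by (intro sum.cong) (auto simp: dual_matrices_def)
      also have "\<dots> = z k * w" using k by (simp add: if_distrib[of "(*) _"] cong: if_cong)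
      finally show ?thesis using w by simp
    qed
    moreover have "z k = 0" if "\<not> k < r" for k
      using that by (simp add: z_def A_def N.twist_tau_def vec_tau_def)
    ultimately have "z k = 0" for k by blast
    then show ?thesis by (simp add: z_def fun_eq_iff)
  qed
  show ?thesis
  proof (rule N.isomorphic_tensor[OF lmN', of "\<lambda>x. A (e x)"])
    show "bij_betw (\<lambda>x. A (e x)) (carrier N') {y. \<forall>k\<ge>r. y k = 0}"
      using bij_betw_trans[OF e.c_bij A_bij] by (simp add: comp_def)
    show "A (e (x \<oplus>\<^bsub>N'\<^esub> y)) = (\<lambda>k. A (e x) k + A (e y) k)" if "x \<in> carrier N'" "y \<in> carrier N'" for x y
      using that by (simp add: A_def e.c_add fun_eq_iff distrib_left sum.distrib)
    show "A (e ([:p:] \<odot>\<^bsub>N'\<^esub> x)) = (\<lambda>k. p * A (e x) k)" if "x \<in> carrier N'" for p x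
      using that by (simp add: A_def e.c_scale fun_eq_iff sum_distrib_left mult_ac)
    show "A (e (tau \<odot>\<^bsub>N'\<^esub> x)) = N.twist_tau (A (e x))" if "x \<in> carrier N'" for x
      using that by (simp add: e.c_tau[OF P'] A_tau)
  qed
qed

end

theorem theorem10p6:
  fixes v :: "'k::field \<Rightarrow> real"
    and j :: "'f::{finite,field} fls alg_closure \<Rightarrow> 'k"
    and q :: nat and \<theta> :: 'k
    and M :: "('k poly poly, 'm) module"
  assumes "C_infinity v j"
    and "q = CARD('f)"
    and "\<theta> = j (to_ac fls_X_inv)"
    and "abelian_T_motive q \<theta> M"
  shows "\<exists>\<mu>0. \<forall>\<mu>\<ge>\<mu>0.
    (\<exists>N :: ('k poly poly, nat \<Rightarrow> 'k poly) module.
       is_mu_dual q \<theta> \<mu> M N \<and> abelian_T_motive q \<theta> N) \<and>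
    (\<forall>(N :: ('k poly poly, 'n) module) (N' :: ('k poly poly, 'n1) module).
       is_mu_dual q \<theta> \<mu> M N \<longrightarrow> is_mu_dual q \<theta> (\<mu> + 1) M N' \<longrightarrow>
       left_module_isomorphic (ring_T_tau q) N' (tensor_motive q N (carlitz_motive q \<theta>)))"
proof -
  interpret C_infinity v j by (rule assms)
  interpret bij_frobenius q "TYPE('k)"
    by unfold_locales
      (use assms(2) freshmans_dream_card power_card_surj in \<open>auto simp: finite_UNIV_card_ge_0\<close>)
  have "left_module (ring_T_tau q) M" using assms(4) by (simp add: abelian_T_motive_def)
  then show ?thesis
    using mu_dual_exists[OF assms(4)] mu_dual_Suc_isomorphic by blast
qed

end
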